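(* Let $f:\mathbb{R}^n\to\mathbb{R}^n$ be locally Lipschitz continuous, and assume that the ODE $\dot{x}(t)=f(x(t))$ has a unique solution map $\phi_f:\mathbb{R}^n\times[0,\infty)\to\mathbb{R}^n$. Suppose $A\subset\mathbb{R}^n$ is an attractor set of this ODE, and let $\Omega\subset\mathbb{R}^n$ be any compact set such that $A\subseteq\Omega^\circ$ and $\Omega\subset BOA_f(A)$. Then there exist a sequence of Sum-of-Squares polynomials $\{P_d\}_{d\in\mathbb{N}}$ with $P_d\in\sum_{SOS}^d$ for all $d\in\mathbb{N}$, a scalar $\alpha>0$ and an integer $N\in\mathbb{N}$ such that: 1. $\nabla P_d(x)^T f(x) < -(P_d(x)-1)$ for all $x\in\Omega$ and $d\ge N$. 2. $P_d(x)>1+\alpha$ for all $x\in\partial\Omega$ and $d\ge N$. 3. $A\subseteq\{x\in\Omega:P_d(x)\le 1\}$ for all $d\ge N$. 4. $\lim_{d\to\infty}D_V(A,\{x\in\Omega:P_d(x)\le 1\})=0$.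
   Context: $\Omega^\circ$ and $\partial\Omega$ denote the interior and boundary of $\Omega$. For $x\in\mathbb{R}^n$ and $A\subset\mathbb{R}^n$, $D(x,A)=D(A,x):=\inf_{y\in A}\|x-y\|_2$; $B(x,\eta):=\{y\in\mathbb{R}^n:\|x-y\|_2<\eta\}$ and $B(A,\eta):=\bigcup_{x\in A}B(x,\eta)$ for $\eta>0$. With $\mu$ the Lebesgue measure on $\mathbb{R}^n$, the volume metric is $D_V(A,B):=\mu((A\setminus B)\cup(B\setminus A))$. A polynomial $p:\mathbb{R}^n\to\mathbb{R}$ is Sum-of-Squares (SOS) if $p=\sum_{i=1}^k p_i^2$ for finitely many real polynomials $p_i$; $\sum_{SOS}^d$ is the set of SOS polynomials on $\mathbb{R}^n$ of degree at most $d$. The solution map $\phi_f:\mathbb{R}^n\times[0,\infty)\to\mathbb{R}^n$ of the ODE satisfies $\frac{\partial}{\partial t}\phi_f(x,t)=f(\phi_f(x,t))$, $\phi_f(x,0)=x$, and $\phi_f(\phi_f(x,t),s)=\phi_f(x,t+s)$ for all $x\in\mathbb{R}^n$ and $s,t\ge 0$. Standing assumption: such a solution map exists and is unique on $\mathbb{R}^n\times[0,\infty)$. Attractor set (short for stable compact attractor set): a set $A\subset\mathbb{R}^n$ is an attractor set of the ODE $\dot x=f(x)$ if (1) $A$ is compact and nonempty; (2) $\phi_f(x,t)\in A$ for all $x\in A$ and $t\ge 0$; (3) for all $x\in A$ there exists $\delta>0$ such that for any $\varepsilon>0$ there exists $T\ge0$ for which $D(\phi_f(y,t),A)<\varepsilon$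 for all $y\in B(x,\delta)$ and $t\ge T$; (4) for all $\varepsilon>0$ there exists $\delta>0$ such that $x\in B(A,\delta)$ implies $D(A,\phi_f(x,t))<\varepsilon$ for all $t\ge 0$. Basin of attraction of an attractor set $A$: $BOA_f(A):=\{x\in\mathbb{R}^n:\lim_{t\to\infty}D(A,\phi_f(x,t))=0\}$. *)

theory Defs
  imports "HOL-Analysis.Analysis"
begin

text \<open>The space \<open>\<real>\<^sup>n\<close> is \<^typ>\<open>real^'n\<close>, whose norm is the Euclidean one; \<open>n = CARD('n)\<close> is arbitrary.
  A polynomial is identified with the function it induces on \<open>\<real>\<^sup>n\<close>, which loses nothing over the reals.
  Monomials are given by exponent vectors \<open>a :: 'n \<Rightarrow> nat\<close>.\<close>

definition multi_indices :: "nat \<Rightarrow> ('n::finite \<Rightarrow> nat) set" where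
  "multi_indices d = {a. (\<Sum>i\<in>UNIV. a i) \<le> d}"

text \<open>Without the following fact the sum in the next definition could silently be 0.\<close>

lemma finite_multi_indices: "finite (multi_indices d :: ('n::finite \<Rightarrow> nat) set)"
proof (rule finite_subset)
  show "multi_indices d \<subseteq> (UNIV::'n set) \<rightarrow>\<^sub>E {..d}"
  proof
    fix a :: "'n \<Rightarrow> nat" assume a: "a \<in> multi_indices d"
    have "a i \<le> d" for i
      using member_le_sum[of i UNIV a] a by (simp add: multi_indices_def)
    then show "a \<in> UNIV \<rightarrow>\<^sub>E {..d}" by (simp add: PiE_UNIV_domain)
  qed
  show "finite ((UNIV::'n set) \<rightarrow>\<^sub>E {..d})"
    by (rule finite_PiE) simp_all
qed

definition poly_degree_le :: "nat \<Rightarrow> (real^'n \<Rightarrow> real) \<Rightarrow> bool" where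
  "poly_degree_le d p \<longleftrightarrow>
     (\<exists>c. \<forall>x. p x = (\<Sum>a\<in>multi_indices d. c a * (\<Prod>i\<in>UNIV. (x $ i) ^ a i)))"

lemma poly_degree_le_imp_polynomial:
  fixes p :: "real^'n \<Rightarrow> real"
  assumes "poly_degree_le d p"
  shows "real_polynomial_function p"
proof -
  obtain c where "\<forall>x. p x = (\<Sum>a\<in>multi_indices d. c a * (\<Prod>i\<in>UNIV. (x $ i) ^ a i))"
    using assms unfolding poly_degree_le_def ..
  then have c: "p = (\<lambda>x. \<Sum>a\<in>multi_indices d. c a * (\<Prod>i\<in>UNIV. (x $ i) ^ a i))"
    by (simp add: fun_eq_iff)
  have "real_polynomial_function (\<lambda>x::real^'n. (x $ i) ^ m)" for i m
    by (rule real_polynomial_function_power[OF real_polynomial_function.intros(1)[OF bounded_linear_vec_nth]])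
  then have "real_polynomial_function (\<lambda>x::real^'n. \<Prod>i\<in>UNIV. (x $ i) ^ a i)" for a
    by (rule real_polynomial_function_prod[OF finite])
  then have "real_polynomial_function (\<lambda>x::real^'n. c a * (\<Prod>i\<in>UNIV. (x $ i) ^ a i))" for a
    by (rule real_polynomial_function.intros(4)[OF real_polynomial_function.intros(2)])
  then show ?thesis
    unfolding c by (rule real_polynomial_function_sum[OF finite_multi_indices])
qed

definition SOS :: "nat \<Rightarrow> (real^'n \<Rightarrow> real) set" where
  "SOS d = {p. poly_degree_le d p \<and>
     (\<exists>(k::nat) q. (\<forall>i<k. real_polynomial_function (q i)) \<and> p = (\<lambda>x. \<Sum>i<k. (q i x)\<^sup>2))}"

definition gradient :: "(real^'n \<Rightarrow> real) \<Rightarrow> real^'n \<Rightarrow> real^'n" where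
  "gradient p x = (THE D. GDERIV p x :> D)"

lemma gradient_eq:
  fixes p :: "real^'n \<Rightarrow> real"
  assumes "GDERIV p x :> D"
  shows "gradient p x = D"
  unfolding gradient_def
proof (rule the_equality)
  show "GDERIV p x :> D" by fact
  fix E assume "GDERIV p x :> E"
  then have "(\<lambda>h. h \<bullet> E) = (\<lambda>h. h \<bullet> D)"
    using assms unfolding gderiv_def by (rule has_derivative_unique)
  from fun_cong[OF this] have "\<forall>h. h \<bullet> E = h \<bullet> D" by simp
  then show "E = D" by (rule vector_eq_ldot[THEN iffD1])
qed

text \<open>Values of \<open>\<phi>\<close> at negative times are irrelevant; the time derivative at \<open>0\<close> is one-sided.\<close>

definition solution_map :: "(real^'n \<Rightarrow> real^'n) \<Rightarrow> (real^'n \<Rightarrow> real \<Rightarrow> real^'n) \<Rightarrow> bool" where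
  "solution_map f \<phi> \<longleftrightarrow>
     (\<forall>x. \<forall>t\<ge>0. (\<phi> x has_vector_derivative f (\<phi> x t)) (at t within {0..})) \<and>
     (\<forall>x. \<phi> x 0 = x) \<and>
     (\<forall>x. \<forall>s\<ge>0. \<forall>t\<ge>0. \<phi> (\<phi> x t) s = \<phi> x (t + s))"

definition unique_solution_map :: "(real^'n \<Rightarrow> real^'n) \<Rightarrow> (real^'n \<Rightarrow> real \<Rightarrow> real^'n) \<Rightarrow> bool" where
  "unique_solution_map f \<phi> \<longleftrightarrow>
     solution_map f \<phi> \<and> (\<forall>\<psi>. solution_map f \<psi> \<longrightarrow> (\<forall>x. \<forall>t\<ge>0. \<psi> x t = \<phi> x t))"

text \<open>Attractors and basins are those of the ODE with solution map \<open>\<phi>\<close>. The library's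
  \<^const>\<open>infdist\<close> is the infimum of the distances for nonempty sets.\<close>

definition attractor_set :: "(real^'n \<Rightarrow> real \<Rightarrow> real^'n) \<Rightarrow> (real^'n) set \<Rightarrow> bool" where
  "attractor_set \<phi> A \<longleftrightarrow>
     compact A \<and> A \<noteq> {} \<and>
     (\<forall>x\<in>A. \<forall>t\<ge>0. \<phi> x t \<in> A) \<and>
     (\<forall>x\<in>A. \<exists>\<delta>>0. \<forall>\<epsilon>>0. \<exists>T\<ge>0. \<forall>y\<in>ball x \<delta>. \<forall>t\<ge>T. infdist (\<phi> y t) A < \<epsilon>) \<and>
     (\<forall>\<epsilon>>0. \<exists>\<delta>>0. \<forall>x\<in>(\<Union>a\<in>A. ball a \<delta>). \<forall>t\<ge>0. infdist (\<phi> x t) A < \<epsilon>)"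

definition basin_of_attraction ::
    "(real^'n \<Rightarrow> real \<Rightarrow> real^'n) \<Rightarrow> (real^'n) set \<Rightarrow> (real^'n) set" where
  "basin_of_attraction \<phi> A = {x. ((\<lambda>t. infdist (\<phi> x t) A) \<longlongrightarrow> 0) at_top}"

definition volume_dist :: "(real^'n) set \<Rightarrow> (real^'n) set \<Rightarrow> ennreal" where
  "volume_dist A B = emeasure lebesgue ((A - B) \<union> (B - A))"

end

theory Submission imports Defs begin

text \<open>No smooth converse Lyapunov theorem is needed. For \<open>e > 0\<close>, stability and compactness give a time \<open>T\<close>
  after which all solutions starting near \<open>\<Omega>\<close> stay within distance \<open>e\<close> of \<open>A\<close>, so that
  \<open>W x = sup {exp t * max 0 (D(\<phi>(x, t), A) - e) | 0 \<le> t \<le> T}\<close> is Lipschitz near \<open>\<Omega>\<close>, vanishes on \<open>A\<close>,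
  is at least \<open>D(x, A) - e\<close>, and decays like \<open>exp (- t)\<close> along solutions. Convolution of a truncation
  of \<open>W\<close> with the Landau kernel \<open>c (1 - |z|\<^sup>2 / R\<^sup>2)\<^sup>k\<close> gives a polynomial \<open>w\<close> directly; difference quotients
  in the direction \<open>f x\<close> show \<open>\<nabla>w \<bullet> f \<le> -w + \<eta>\<close> on \<open>\<Omega>\<close>, with \<open>\<eta>\<close> as small as desired. The SOS polynomials are
  \<open>(1 - e + w)\<^sup>2\<close> with \<open>e \<rightarrow> 0\<close>, traversed slowly enough for the degree constraint.\<close>

section \<open>Polynomials and their degrees\<close>

lemma poly_degree_le_monomial:
  fixes a :: "'n::finite \<Rightarrow> nat"
  assumes "a \<in> multi_indices d"
  shows "poly_degree_le d (\<lambda>x::real^'n. k * (\<Prod>i\<in>UNIV. (x $ i) ^ a i))"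
  unfolding poly_degree_le_def
proof (intro exI[of _ "\<lambda>b. if b = a then k else 0"] allI)
  fix x :: "real^'n"
  have "(\<Sum>b\<in>multi_indices d. (if b = a then k else 0) * (\<Prod>i\<in>UNIV. (x $ i) ^ b i)) =
      (\<Sum>b\<in>multi_indices d. if b = a then k * (\<Prod>i\<in>UNIV. (x $ i) ^ b i) else 0)"
    by (intro sum.cong) auto
  also have "\<dots> = k * (\<Prod>i\<in>UNIV. (x $ i) ^ a i)"
    using assms by (simp add: sum.delta' finite_multi_indices)
  finally show "k * (\<Prod>i\<in>UNIV. (x $ i) ^ a i) =
      (\<Sum>b\<in>multi_indices d. (if b = a then k else 0) * (\<Prod>i\<in>UNIV. (x $ i) ^ b i))" ..
qed

lemma poly_degree_le_const: "poly_degree_le d (\<lambda>x. k)"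
  using poly_degree_le_monomial[of "\<lambda>_. 0" d k] by (simp add: multi_indices_def)

lemma poly_degree_le_component: "poly_degree_le 1 (\<lambda>x::real^'n. k * x $ j)"
proof -
  have "(\<lambda>i::'n. of_bool (i = j)) \<in> multi_indices 1"
    by (simp add: multi_indices_def of_bool_def)
  from poly_degree_le_monomial[OF this, of k] show ?thesis
    by (simp add: of_bool_def if_distrib[of "\<lambda>e. _ ^ e"] cong: if_cong)
qed

lemma poly_degree_le_add:
  assumes "poly_degree_le d p" "poly_degree_le d q"
  shows "poly_degree_le d (\<lambda>x. p x + q x)"
proof -
  from assms obtain b c where
    "\<forall>x. p x = (\<Sum>a\<in>multi_indices d. b a * (\<Prod>i\<in>UNIV. (x $ i) ^ a i))"
    "\<forall>x. q x = (\<Sum>a\<in>multi_indices d. c a * (\<Prod>i\<in>UNIV. (x $ i) ^ a i))"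
    unfolding poly_degree_le_def by blast
  then show ?thesis
    unfolding poly_degree_le_def
    by (intro exI[of _ "\<lambda>a. b a + c a"]) (simp add: distrib_right sum.distrib)
qed

lemma poly_degree_le_sum:
  assumes "finite I" "\<And>i. i \<in> I \<Longrightarrow> poly_degree_le d (p i)"
  shows "poly_degree_le d (\<lambda>x. \<Sum>i\<in>I. p i x)"
  using assms by (induction I rule: finite_induct) (auto intro: poly_degree_le_const poly_degree_le_add)

lemma poly_degree_le_mult:
  fixes p q :: "real^'n \<Rightarrow> real"
  assumes "poly_degree_le d p" "poly_degree_le e q"
  shows "poly_degree_le (d + e) (\<lambda>x. p x * q x)"
proof -
  let ?m = "\<lambda>(a::'n \<Rightarrow> nat) (x::real^'n). \<Prod>i\<in>UNIV. (x $ i) ^ a i"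
  from assms obtain b c where
    b: "\<forall>x. p x = (\<Sum>a\<in>multi_indices d. b a * ?m a x)" and
    c: "\<forall>x. q x = (\<Sum>a\<in>multi_indices e. c a * ?m a x)"
    unfolding poly_degree_le_def by blast
  have "p x * q x = (\<Sum>r\<in>multi_indices d. \<Sum>s\<in>multi_indices e. (b r * c s) * ?m (\<lambda>i. r i + s i) x)" for x
    by (simp add: b c sum_product power_add prod.distrib algebra_simps)
  moreover have "poly_degree_le (d + e) (\<lambda>x. \<Sum>r\<in>multi_indices d. \<Sum>s\<in>multi_indices e.
      (b r * c s) * ?m (\<lambda>i. r i + s i) x)"
    by (intro poly_degree_le_sum finite_multi_indices poly_degree_le_monomial)
       (auto simp: multi_indices_def sum.distrib intro: add_mono)
  ultimately show ?thesis by simp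
qed

lemma poly_degree_le_mono:
  assumes "poly_degree_le d p" "d \<le> e"
  shows "poly_degree_le e p"
  \<comment> \<open>The second factor is the constant 1, regarded as a polynomial of degree at most
    \<open>e - d\<close>.\<close>
  using poly_degree_le_mult[OF assms(1) poly_degree_le_const[of "e - d" 1]] assms(2) by simp

text \<open>Mollification yields polynomials without a degree bound; this supplies the one that
  \<open>SOS d\<close> asks for. The only nontrivial case is a linear functional, which is expanded
  in coordinates.\<close>

lemma real_polynomial_function_imp_poly_degree_le:
  fixes p :: "real^'n \<Rightarrow> real"
  assumes "real_polynomial_function p"
  obtains d where "poly_degree_le d p"
proof -
  from assms have "\<exists>d. poly_degree_le d p"
  proof (induction p rule: real_polynomial_function.induct)
    case (linear h)
    then have "linear h" by (rule bounded_linear.linear)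
    have "h x = (\<Sum>i\<in>UNIV. h (axis i 1) * x $ i)" for x
    proof -
      have "h x = h (\<Sum>i\<in>UNIV. (x $ i) *\<^sub>R axis i 1)"
        by (simp only: basis_expansion flip: scalar_mult_eq_scaleR)
      also have "\<dots> = (\<Sum>i\<in>UNIV. h (axis i 1) * x $ i)"
        by (simp only: linear_sum[OF \<open>linear h\<close>] linear_cmul[OF \<open>linear h\<close>] real_scaleR_def mult.commute)
      finally show ?thesis .
    qed
    then have h: "h = (\<lambda>x. \<Sum>i\<in>UNIV. h (axis i 1) * x $ i)" by blast
    have "poly_degree_le 1 (\<lambda>x. \<Sum>i\<in>UNIV. h (axis i 1) * x $ i)"
      by (intro poly_degree_le_sum poly_degree_le_component finite)
    then have "poly_degree_le 1 h" unfolding h[symmetric] .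
    then show ?case by blast
  next
    case (const c) then show ?case using poly_degree_le_const by blast
  next
    case (add p q)
    then obtain d e where "poly_degree_le d p" "poly_degree_le e q" by blast
    then have "poly_degree_le (max d e) (\<lambda>x. p x + q x)"
      by (intro poly_degree_le_add) (auto elim: poly_degree_le_mono)
    then show ?case by blast
  next
    case (mult p q) then show ?case using poly_degree_le_mult by blast
  qed
  with that show ?thesis by blast
qed

section \<open>Mollification by polynomials\<close>

lemma integrable_compact_support:
  fixes g :: "'a::euclidean_space \<Rightarrow> real"
  assumes "continuous_on UNIV g" "\<And>y. norm y > r \<Longrightarrow> g y = 0"
  shows "integrable lborel g"
proof -
  have "integrable lborel (\<lambda>x. indicator (cball 0 r) x *\<^sub>R g x)"
    by (rule borel_integrable_compact) (auto intro: continuous_on_subset assms(1))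
  also have "(\<lambda>x. indicator (cball 0 r) x *\<^sub>R g x) = g"
    using assms(2) by (force simp: indicator_def)
  finally show ?thesis .
qed

text \<open>Expanding \<open>norm (x - y)\<close> squared separates \<open>x\<close> from
  \<open>y\<close>. Splitting off one factor of the kernel leaves integrals of the same kind with
  exponent \<open>k\<close> and weights \<open>V\<close> times a polynomial in \<open>y\<close>,
  hence the induction over all compactly supported \<open>V\<close>.\<close>

lemma real_polynomial_function_integral_power:
  fixes V :: "'a::euclidean_space \<Rightarrow> real"
  assumes "continuous_on UNIV V" "\<And>y. norm y > r \<Longrightarrow> V y = 0"
  shows "real_polynomial_function (\<lambda>x. \<integral>y. V y * (1 - b * (norm (x - y))\<^sup>2) ^ k \<partial>lborel)"
  using assms
proof (induction k arbitrary: V)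
  case 0
  then show ?case by (simp add: real_polynomial_function.intros(2))
next
  case (Suc k)
  let ?G = "\<lambda>x y. (1 - b * (norm (x - y))\<^sup>2) ^ k"
  let ?V0 = "\<lambda>y. V y * (1 - b * (norm y)\<^sup>2)"
  let ?V1 = "\<lambda>i y. V y * (y \<bullet> i)"
  have int: "integrable lborel (\<lambda>y. U y * ?G x y)"
    if "continuous_on UNIV U" "\<And>y. norm y > r \<Longrightarrow> U y = 0" for U x
    by (rule integrable_compact_support[where r = r]) (auto intro!: continuous_intros that)
  have c0: "continuous_on UNIV ?V0" "\<And>y. norm y > r \<Longrightarrow> ?V0 y = 0"
    and c1: "continuous_on UNIV (?V1 i)" "\<And>y. norm y > r \<Longrightarrow> ?V1 i y = 0" for i
    using Suc.prems by (auto intro!: continuous_intros)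
  have "(\<integral>y. V y * (1 - b * (norm (x - y))\<^sup>2) ^ Suc k \<partial>lborel) =
      (\<integral>y. ?V0 y * ?G x y \<partial>lborel) - b * (x \<bullet> x) * (\<integral>y. V y * ?G x y \<partial>lborel)
       + (\<Sum>i\<in>Basis. 2 * b * (x \<bullet> i) * (\<integral>y. ?V1 i y * ?G x y \<partial>lborel))" for x
  proof -
    have id: "1 - b * (norm (x - y))\<^sup>2 =
        (1 - b * (norm y)\<^sup>2) - b * (x \<bullet> x) + 2 * b * (\<Sum>i\<in>Basis. (x \<bullet> i) * (y \<bullet> i))" for y
      unfolding power2_norm_eq_inner euclidean_inner[of x y, symmetric]
      by (simp add: inner_diff_left inner_diff_right inner_commute algebra_simps)
    have "V y * ((1 - b * (norm (x - y))\<^sup>2) * g) =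
        ?V0 y * g - b * (x \<bullet> x) * (V y * g) + (\<Sum>i\<in>Basis. 2 * b * (x \<bullet> i) * (?V1 i y * g))" for y g
      by (subst id) (simp add: algebra_simps sum_distrib_left)
    then show ?thesis
      using int[OF c0] int[OF c1] int[OF Suc.prems] by simp
  qed
  moreover have "real_polynomial_function (\<lambda>x. 
      (\<integral>y. ?V0 y * ?G x y \<partial>lborel) - b * (x \<bullet> x) * (\<integral>y. V y * ?G x y \<partial>lborel)
       + (\<Sum>i\<in>Basis. 2 * b * (x \<bullet> i) * (\<integral>y. ?V1 i y * ?G x y \<partial>lborel)))"
    unfolding euclidean_inner[of "x" "x" for x]
    by (intro real_polynomial_function.intros(2-4) real_polynomial_function_diff real_polynomial_function_sum
         Suc.IH c0 c1 Suc.prems real_polynomial_function.intros(1) bounded_linear_inner_left finite_Basis)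
  ultimately show ?case by simp
qed

text \<open>High powers of a profile with its maximum at 0 concentrate there: the mass beyond radius
  \<delta>, relative to the mass within \<delta>/2, is at most a geometric sequence times a ratio of
  volumes.\<close>

lemma landau_kernel:
  fixes R \<delta> m :: real
  assumes "0 < \<delta>" "\<delta> \<le> R" "0 < m"
  obtains k :: nat and c :: real where "k > 0" "c > 0"
    "(\<integral>z. c * max 0 (1 - (norm (z::'a::euclidean_space))\<^sup>2 / R\<^sup>2) ^ k \<partial>lborel) = 1"
    "(\<integral>z. indicator {z. \<delta> \<le> norm (z::'a)} z * (c * max 0 (1 - (norm z)\<^sup>2 / R\<^sup>2) ^ k) \<partial>lborel) \<le> m"
proof -
  define s where "s = (\<lambda>z::'a. max 0 (1 - (norm z)\<^sup>2 / R\<^sup>2))"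
  \<comment> \<open>\<open>q0\<close> bounds the profile from above at radius at least \<delta>, and
    \<open>q1\<close> bounds it from below within \<delta>/2.\<close>
  define q0 where "q0 = 1 - \<delta>\<^sup>2 / R\<^sup>2"
  define q1 where "q1 = 1 - (\<delta>/2)\<^sup>2 / R\<^sup>2"
  define v where "v = measure lborel (ball (0::'a) (\<delta>/2))"
  define U where "U = measure lborel (cball (0::'a) R)"
  have "R > 0" using assms by simp
  have "\<delta>\<^sup>2 / R\<^sup>2 \<le> 1" using assms \<open>R > 0\<close> by (simp add: power_mono)
  moreover have "\<delta>\<^sup>2 / R\<^sup>2 > 0" using assms \<open>R > 0\<close> by simp
  ultimately have q: "0 \<le> q0" "q0 < q1" "q1 > 0"
    unfolding q0_def q1_def power_divide by simp_all
  have "v > 0"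
    unfolding v_def using assms by (intro content_ball_pos) simp
  have "U \<ge> 0" unfolding U_def by simp
  have "(\<lambda>k. (q0/q1)^k) \<longlonglongrightarrow> 0"
    using q by (intro LIMSEQ_power_zero) simp
  then have "(\<lambda>k. (q0/q1)^k * (U / v)) \<longlonglongrightarrow> 0" by (rule tendsto_mult_left_zero)
  with \<open>m > 0\<close> have "eventually (\<lambda>k. (q0/q1)^k * (U / v) < m) sequentially"
    by (rule order_tendstoD(2)[rotated])
  with eventually_gt_at_top[of 0] have "eventually (\<lambda>k. 0 < k \<and> (q0/q1)^k * (U / v) < m) sequentially"
    by (rule eventually_conj)
  \<comment> \<open>Positivity of \<open>k\<close> matters beyond radius \<open>R\<close>: since
    \<open>0 ^ 0 = 1\<close>, the power of the truncated profile would not vanish there for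
    \<open>k = 0\<close>.\<close>
  then obtain k :: nat where k: "k > 0" "(q0/q1)^k * (U / v) < m"
    using eventually_happens'[OF sequentially_bot] by blast
  have s0: "s z = 0" if "norm z > R" for z
  proof -
    have "1 \<le> (norm z)\<^sup>2 / R\<^sup>2" using that \<open>R > 0\<close> by (simp add: power_mono)
    then show ?thesis by (simp add: s_def)
  qed
  have int: "integrable lborel (\<lambda>z. s z ^ k)"
    by (rule integrable_compact_support[where r = R])
       (use s0 k \<open>R > 0\<close> in \<open>auto simp: s_def intro!: continuous_intros\<close>)
  have s_nonneg: "s z \<ge> 0" for z by (simp add: s_def)
  define S where "S = (\<integral>z. s z ^ k \<partial>lborel)"
  have "q1 ^ k * v = (\<integral>z. indicator (ball (0::'a) (\<delta>/2)) z * q1^k \<partial>lborel)"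
    by (simp add: v_def)
  also have "\<dots> \<le> S"
    unfolding S_def
  proof (rule integral_mono[OF _ int])
    show "integrable lborel (\<lambda>z. indicat_real (ball (0::'a) (\<delta>/2)) z * q1 ^ k)"
      by (intro integrable_mult_left integrable_real_indicator emeasure_bounded_finite) auto
    show "indicat_real (ball 0 (\<delta>/2)) z * q1 ^ k \<le> s z ^ k" for z
    proof (cases "norm z < \<delta>/2")
      case True
      then have "(norm z)\<^sup>2 / R\<^sup>2 \<le> (\<delta>/2)\<^sup>2 / R\<^sup>2"
        by (intro divide_right_mono power_mono) auto
      then have "q1 \<le> s z" by (simp add: q1_def s_def)
      with True q show ?thesis by (simp add: power_mono)
    qed (simp add: s_nonneg)
  qed
  finally have S: "q1 ^ k * v \<le> S" .
  moreover have "q1 ^ k * v > 0" using q \<open>v > 0\<close> by simp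
  ultimately have "S > 0" by simp
  let ?I = "indicat_real {z::'a. \<delta> \<le> norm z}"
  have "closed {z::'a. \<delta> \<le> norm z}" by (intro closed_Collect_le continuous_intros)
  then have I: "{z::'a. \<delta> \<le> norm z} \<in> sets lborel" by simp
  have "(\<integral>z. ?I z * s z ^ k \<partial>lborel) \<le> (\<integral>z. indicator (cball (0::'a) R) z * q0^k \<partial>lborel)"
  proof (rule integral_mono)
    show "integrable lborel (\<lambda>z. ?I z * s z ^ k)"
      using integrable_mult_indicator[OF I int] by simp
    show "integrable lborel (\<lambda>z. indicat_real (cball (0::'a) R) z * q0 ^ k)"
      by (intro integrable_mult_left integrable_real_indicator emeasure_bounded_finite) auto
    show "?I z * s z ^ k \<le> indicat_real (cball 0 R) z * q0 ^ k" for z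
    proof (cases "\<delta> \<le> norm z \<and> norm z \<le> R")
      case True
      then have "\<delta>\<^sup>2 / R\<^sup>2 \<le> (norm z)\<^sup>2 / R\<^sup>2"
        using assms by (intro divide_right_mono power_mono) auto
      with q(1) have "s z \<le> q0" by (simp add: q0_def s_def)
      with True q show ?thesis by (simp add: power_mono s_nonneg)
    next
      case False
      then show ?thesis using s0[of z] k(1) q(1) by (auto simp: indicator_def zero_power)
    qed
  qed
  also have "\<dots> = q0 ^ k * U" by (simp add: U_def)
  finally have num: "(\<integral>z. ?I z * s z ^ k \<partial>lborel) \<le> q0 ^ k * U" .
  show thesis
  proof (rule that[of k "1/S"])
    show "k > 0" "1/S > 0" using k \<open>S > 0\<close> by simp_all
    show "(\<integral>z. (1/S) * max 0 (1 - (norm (z::'a))\<^sup>2 / R\<^sup>2) ^ k \<partial>lborel) = 1"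
      using \<open>S > 0\<close> by (simp add: S_def s_def)
    have "(\<lambda>z. ?I z * ((1/S) * max 0 (1 - (norm z)\<^sup>2 / R\<^sup>2) ^ k)) = (\<lambda>z. ?I z * s z ^ k / S)"
      by (simp add: s_def fun_eq_iff)
    then have "(\<integral>z. ?I z * ((1/S) * max 0 (1 - (norm z)\<^sup>2 / R\<^sup>2) ^ k) \<partial>lborel) =
        (\<integral>z. ?I z * s z ^ k \<partial>lborel) / S"
      by (simp only: integral_divide_zero)
    also have "\<dots> \<le> (q0 ^ k * U) / (q1 ^ k * v)"
      using num S q \<open>v > 0\<close> \<open>U \<ge> 0\<close> \<open>q1 ^ k * v > 0\<close> by (intro frac_le) auto
    also have "\<dots> = (q0/q1)^k * (U / v)" by (simp add: power_divide)
    also have "\<dots> \<le> m" using k by simp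
    finally show "(\<integral>z. ?I z * ((1/S) * max 0 (1 - (norm z)\<^sup>2 / R\<^sup>2) ^ k) \<partial>lborel) \<le> m" .
  qed
qed

lemma integral_lborel_translation:
  fixes g :: "'a::euclidean_space \<Rightarrow> real"
  assumes [measurable]: "g \<in> borel_measurable borel"
  shows "(\<integral>z. g (a + z) \<partial>lborel) = (\<integral>y. g y \<partial>lborel)"
  by (subst (2) lborel_distr_plus[of a, symmetric], subst integral_distr) simp_all

text \<open>No derivative of \<open>V\<close> is taken: a difference quotient of \<open>w\<close> is
  an average of difference quotients of \<open>V\<close>, controlled by \<open>decay\<close> for
  shifts below \<delta> and by the Lipschitz bound on the light tail. The convolution shifts the
  base point but not the direction, which is why \<open>decay\<close> pairs the direction
  \<open>v x\<close> with all \<open>y\<close> near \<open>x\<close>.\<close>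

lemma polynomial_mollification:
  fixes V :: "'a::euclidean_space \<Rightarrow> real" and v :: "'a \<Rightarrow> 'a"
  assumes lip: "L-lipschitz_on UNIV V"
    and supp: "\<And>y. norm y > r \<Longrightarrow> V y = 0"
    and \<Omega>: "\<And>x. x \<in> \<Omega> \<Longrightarrow> norm x \<le> r" "\<And>x. x \<in> \<Omega> \<Longrightarrow> norm (v x) \<le> M"
    and nonneg: "0 \<le> r" "0 \<le> M"
    and decay: "\<And>\<kappa>. \<kappa> > 0 \<Longrightarrow> \<exists>\<delta>>0. \<exists>h0>0. \<forall>x\<in>\<Omega>. \<forall>y\<in>ball x \<delta>. \<forall>h. 0 < h \<and> h < h0 \<longrightarrow>
                  V (y + h *\<^sub>R v x) - V y \<le> h * (\<kappa> - V x)"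
    and "\<eta> > 0"
  obtains w where "real_polynomial_function w"
    and "\<And>x. x \<in> \<Omega> \<Longrightarrow> \<bar>w x - V x\<bar> \<le> \<eta>"
    and "\<And>x D. x \<in> \<Omega> \<Longrightarrow> GDERIV w x :> D \<Longrightarrow> D \<bullet> v x \<le> \<eta> - V x"
proof -
  have "L \<ge> 0" using lip by (rule lipschitz_on_nonneg)
  have V_diff: "\<bar>V x - V y\<bar> \<le> L * norm (x - y)" for x y
    using lipschitz_onD[OF lip, of x y] by (simp add: dist_norm)
  have V_cont: "continuous_on UNIV V" using lip by (rule lipschitz_on_continuous_on)
  obtain b where "b > 0" and b: "\<bar>V y\<bar> \<le> b" for y
  proof -
    have "bounded (V ` cball 0 r)"
      using V_cont by (intro compact_imp_bounded compact_continuous_image) (auto intro: continuous_on_subset)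
    then obtain b where b: "b > 0" "\<And>y. y \<in> cball 0 r \<Longrightarrow> \<bar>V y\<bar> \<le> b"
      unfolding bounded_pos by auto
    moreover have "\<bar>V y\<bar> \<le> b" for y
      using b supp[of y] by (cases "norm y \<le> r") auto
    ultimately show ?thesis using that by blast
  qed
  \<comment> \<open>Points of norm at most \<open>r + 1\<close> and points of the support of
    \<open>V\<close> are less than \<open>R\<close> apart, so the truncation in the kernel is
    inactive between them.\<close>
  define R where "R = 2 * r + 2"
  define \<kappa> where "\<kappa> = \<eta> / 2"
  have "\<kappa> > 0" using \<open>\<eta> > 0\<close> by (simp add: \<kappa>_def)
  from decay[OF this] obtain \<delta>1 h0 where "\<delta>1 > 0" "h0 > 0" and decay1:
    "\<And>x y h. x \<in> \<Omega> \<Longrightarrow> y \<in> ball x \<delta>1 \<Longrightarrow> 0 < h \<Longrightarrow> h < h0 \<Longrightarrow> V (y + h *\<^sub>R v x) - V y \<le> h * (\<kappa> - V x)"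
    by blast
  define \<delta> where "\<delta> = min 1 (min \<delta>1 (\<eta> / (2 * (L + 1))))"
  have \<delta>: "\<delta> > 0" "\<delta> \<le> \<delta>1" "\<delta> \<le> R" "L * \<delta> \<le> \<eta> / 2"
  proof -
    show "\<delta> > 0" "\<delta> \<le> \<delta>1" "\<delta> \<le> R"
      using \<open>\<delta>1 > 0\<close> \<open>\<eta> > 0\<close> \<open>L \<ge> 0\<close> nonneg by (auto simp: \<delta>_def R_def)
    have "L * \<delta> \<le> L * (\<eta> / (2 * (L + 1)))"
      using \<open>L \<ge> 0\<close> by (intro mult_left_mono) (auto simp: \<delta>_def)
    also have "\<dots> \<le> \<eta> / 2" using \<open>L \<ge> 0\<close> \<open>\<eta> > 0\<close> by (simp add: field_simps)
    finally show "L * \<delta> \<le> \<eta> / 2" .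
  qed
  \<comment> \<open>On the tail, \<open>c2\<close> absorbs both the error \<open>2 * b\<close> in
    the value of \<open>V\<close> and the failure of \<open>decay\<close> for a difference quotient.
    The choice of \<open>m\<close> below gives \<open>c2 * m = \<eta> / 2\<close>.\<close>
  define c2 where "c2 = L * M + \<kappa> + 2 * b"
  have "c2 > 0" using \<open>L \<ge> 0\<close> nonneg \<open>\<kappa> > 0\<close> \<open>b > 0\<close> by (simp add: c2_def add_nonneg_pos)
  define m where "m = \<eta> / (2 * c2)"
  have "m > 0" using \<open>c2 > 0\<close> \<open>\<eta> > 0\<close> by (simp add: m_def)
  from landau_kernel[OF \<delta>(1,3) this, where 'a = 'a] obtain k c where "k > 0" "c > 0" and
    one: "(\<integral>z. c * max 0 (1 - (norm (z::'a))\<^sup>2 / R\<^sup>2) ^ k \<partial>lborel) = 1" and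
    tail: "(\<integral>z. indicator {z. \<delta> \<le> norm (z::'a)} z * (c * max 0 (1 - (norm z)\<^sup>2 / R\<^sup>2) ^ k) \<partial>lborel) \<le> m"
    by blast
  define \<psi> where "\<psi> = (\<lambda>z::'a. c * max 0 (1 - (norm z)\<^sup>2 / R\<^sup>2) ^ k)"
  let ?I = "indicat_real {z::'a. \<delta> \<le> norm z}"
  have "R > 0" using nonneg by (simp add: R_def)
  have \<psi>_nonneg: "\<psi> z \<ge> 0" for z using \<open>c > 0\<close> by (simp add: \<psi>_def)
  have \<psi>_cont: "continuous_on UNIV \<psi>"
    unfolding \<psi>_def using \<open>R > 0\<close> by (auto intro!: continuous_intros)
  have \<psi>_supp: "\<psi> z = 0" if "norm z > R" for z
  proof -
    have "1 \<le> (norm z)\<^sup>2 / R\<^sup>2" using that \<open>R > 0\<close> by (simp add: power_mono)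
    then show ?thesis using \<open>k > 0\<close> by (simp add: \<psi>_def)
  qed
  have \<psi>_int: "integrable lborel \<psi>" by (rule integrable_compact_support[OF \<psi>_cont \<psi>_supp])
  have "closed {z::'a. \<delta> \<le> norm z}" by (intro closed_Collect_le continuous_intros)
  then have "{z::'a. \<delta> \<le> norm z} \<in> sets lborel" by simp
  from integrable_mult_indicator[OF this \<psi>_int]
  have tail_int: "integrable lborel (\<lambda>z. ?I z * \<psi> z)" by simp
  \<comment> \<open>\<psi> is a probability density with tail mass at most \<open>m\<close>, so
    pointwise bounds with a penalty \<open>q\<close> on the tail can be averaged.\<close>
  have mean: "(\<integral>z. g z * \<psi> z \<partial>lborel) \<le> p + q * m"
    if "\<And>z. g z \<le> p + q * ?I z" "q \<ge> 0" "integrable lborel (\<lambda>z. g z * \<psi> z)" for g p q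
  proof -
    have "(\<integral>z. g z * \<psi> z \<partial>lborel) \<le> (\<integral>z. p * \<psi> z + q * (?I z * \<psi> z) \<partial>lborel)"
    proof (rule integral_mono[OF that(3)])
      show "integrable lborel (\<lambda>z. p * \<psi> z + q * (?I z * \<psi> z))"
        using \<psi>_int tail_int by simp
      show "g z * \<psi> z \<le> p * \<psi> z + q * (?I z * \<psi> z)" for z
        using mult_right_mono[OF that(1) \<psi>_nonneg] by (simp add: algebra_simps)
    qed
    also have "\<dots> = p + q * (\<integral>z. ?I z * \<psi> z \<partial>lborel)"
      using \<psi>_int tail_int one by (simp add: \<psi>_def)
    also have "\<dots> \<le> p + q * m"
      using tail \<open>q \<ge> 0\<close> by (simp add: \<psi>_def mult_left_mono)
    finally show ?thesis .
  qed
  have conv_int: "integrable lborel (\<lambda>z. V (a + z) * \<psi> z)" for a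
    by (rule integrable_compact_support[where r = R])
       (use \<psi>_supp in \<open>auto intro!: continuous_intros \<psi>_cont continuous_on_compose2[OF V_cont]\<close>)
  define w where "w = (\<lambda>x. c * (\<integral>y. V y * (1 - (1 / R\<^sup>2) * (norm (x - y))\<^sup>2) ^ k \<partial>lborel))"
  have w_poly: "real_polynomial_function w"
    unfolding w_def
    by (intro real_polynomial_function.intros(2,4) real_polynomial_function_integral_power[OF V_cont supp])
  \<comment> \<open>The polynomial \<open>w\<close> is the convolution with the truncated kernel
    only near \<Omega>. The extra 1 in the radius leaves room for the step
    \<open>h *\<^sub>R v x\<close>.\<close>
  have w_eq: "w x = (\<integral>z. V (x + z) * \<psi> z \<partial>lborel)" if x: "norm x \<le> r + 1" for x
  proof -
    have "c * (V y * (1 - (1 / R\<^sup>2) * (norm (x - y))\<^sup>2) ^ k) = V y * \<psi> (y - x)" for y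
    proof (cases "norm y \<le> r")
      case True
      then have "norm (y - x) \<le> R" using x norm_triangle_ineq4[of y x] by (simp add: R_def)
      then have "(norm (y - x))\<^sup>2 / R\<^sup>2 \<le> 1" using \<open>R > 0\<close> by (simp add: power_mono)
      then show ?thesis by (simp add: \<psi>_def norm_minus_commute)
    qed (simp add: supp)
    then have "w x = (\<integral>y. V y * \<psi> (y - x) \<partial>lborel)"
      unfolding w_def by (simp only: integral_mult_right_zero[symmetric])
    also have "\<dots> = (\<integral>z. V (x + z) * \<psi> (x + z - x) \<partial>lborel)"
      by (rule integral_lborel_translation[symmetric])
         (intro borel_measurable_continuous_onI continuous_intros V_cont
            continuous_on_compose2[OF \<psi>_cont], auto)
    finally show ?thesis by simp
  qed
  show thesis
  proof (rule that[OF w_poly])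
    fix x assume "x \<in> \<Omega>"
    then have x: "norm x \<le> r" "norm (v x) \<le> M" using \<Omega> by auto
    have I_cases: "norm z < \<delta> \<and> ?I z = 0 \<or> ?I z = 1" for z by (auto simp: indicator_def)
    have c2m: "c2 * m = \<eta> / 2" using \<open>c2 > 0\<close> by (simp add: m_def)
    have near: "\<bar>V (x + z) - V x\<bar> \<le> \<eta> / 2 + c2 * ?I z" for z
      using I_cases[of z]
    proof
      assume z: "norm z < \<delta> \<and> ?I z = 0"
      have "\<bar>V (x + z) - V x\<bar> \<le> L * norm z" using V_diff[of "x + z" x] by simp
      also have "\<dots> \<le> L * \<delta>" using z \<open>L \<ge> 0\<close> by (intro mult_left_mono) auto
      finally show ?thesis using \<delta> z by simp
    next
      assume "?I z = 1"
      moreover have "0 \<le> L * M" using \<open>L \<ge> 0\<close> nonneg by simp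
      ultimately show ?thesis using b[of "x + z"] b[of x] \<open>\<kappa> > 0\<close> \<open>\<eta> > 0\<close> by (simp add: c2_def)
    qed
    have wx: "w x - V x = (\<integral>z. (V (x + z) - V x) * \<psi> z \<partial>lborel)"
      using w_eq[of x] x conv_int[of x] \<psi>_int one by (simp add: left_diff_distrib \<psi>_def)
    have int: "integrable lborel (\<lambda>z. (V (x + z) - V x) * \<psi> z)"
      using conv_int[of x] \<psi>_int by (simp add: left_diff_distrib)
    have "w x - V x \<le> \<eta> / 2 + c2 * m"
      unfolding wx using near \<open>c2 > 0\<close> by (intro mean int) (auto simp: abs_le_iff)
    moreover have "(\<integral>z. (- (V (x + z) - V x)) * \<psi> z \<partial>lborel) \<le> \<eta> / 2 + c2 * m"
      using near \<open>c2 > 0\<close> integrable_minus[OF int]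
      by (intro mean) (auto simp: abs_le_iff algebra_simps)
    then have "- (w x - V x) \<le> \<eta> / 2 + c2 * m"
      unfolding wx by (simp del: minus_diff_eq)
    ultimately show "\<bar>w x - V x\<bar> \<le> \<eta>" using c2m by (simp add: abs_le_iff)

    fix D assume D: "GDERIV w x :> D"
    \<comment> \<open>The bound \<open>1 / (M + 1)\<close> keeps the step shorter than 1, so that
      \<open>w_eq\<close> applies at its end point.\<close>
    define h1 where "h1 = min h0 (1 / (M + 1))"
    have "h1 > 0" using \<open>h0 > 0\<close> nonneg by (simp add: h1_def)
    have quot: "(w (x + h *\<^sub>R v x) - w x) / h \<le> \<eta> - V x" if h: "0 < h" "h < h1" for h
    proof -
      have "norm (h *\<^sub>R v x) \<le> 1 / (M + 1) * M"
        unfolding norm_scaleR using h x nonneg by (intro mult_mono) (auto simp: h1_def)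
      also have "\<dots> \<le> 1" using nonneg by simp
      finally have "norm (x + h *\<^sub>R v x) \<le> r + 1"
        using x norm_triangle_ineq[of x "h *\<^sub>R v x"] by linarith
      then have "w (x + h *\<^sub>R v x) - w x = (\<integral>z. (V (x + h *\<^sub>R v x + z) - V (x + z)) * \<psi> z \<partial>lborel)"
        using w_eq x conv_int by (simp add: left_diff_distrib)
      also have "\<dots> \<le> h * (\<kappa> - V x) + (h * c2) * m"
      proof (rule mean)
        show "0 \<le> h * c2" using h \<open>c2 > 0\<close> by simp
        show "integrable lborel (\<lambda>z. (V (x + h *\<^sub>R v x + z) - V (x + z)) * \<psi> z)"
          using conv_int by (simp add: left_diff_distrib)
        show "V (x + h *\<^sub>R v x + z) - V (x + z) \<le> h * (\<kappa> - V x) + h * c2 * ?I z" for z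
          using I_cases[of z]
        proof
          assume z: "norm z < \<delta> \<and> ?I z = 0"
          then have "x + z \<in> ball x \<delta>1" using \<delta> by (simp add: dist_norm)
          from decay1[OF \<open>x \<in> \<Omega>\<close> this h(1)] h(2) z show ?thesis
            by (simp add: h1_def add_ac)
        next
          assume z: "?I z = 1"
          have "V (x + h *\<^sub>R v x + z) - V (x + z) \<le> L * norm (h *\<^sub>R v x)"
            using V_diff[of "x + h *\<^sub>R v x + z" "x + z"] by (simp add: abs_le_iff)
          also have "\<dots> \<le> h * (L * M)"
            using h x \<open>L \<ge> 0\<close> by (simp add: mult_left_mono mult.left_commute)
          also have "\<dots> \<le> h * (\<kappa> - V x + c2)"
            using h b[of x] \<open>\<kappa> > 0\<close> by (intro mult_left_mono) (auto simp: c2_def)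
          finally show ?thesis using z by (simp add: algebra_simps)
        qed
      qed
      also have "\<dots> = h * (\<kappa> - V x + c2 * m)" by (simp add: algebra_simps)
      also have "\<dots> = h * (\<eta> - V x)" unfolding c2m by (simp add: \<kappa>_def)
      finally show ?thesis using h by (simp add: field_simps)
    qed
    have "((\<lambda>h. w (x + h *\<^sub>R v x)) has_derivative (\<lambda>t. (t *\<^sub>R v x) \<bullet> D)) (at 0)"
      using D unfolding gderiv_def
      by (intro has_derivative_compose[of "\<lambda>h. x + h *\<^sub>R v x" _ 0 UNIV w]) (auto intro!: derivative_eq_intros)
    then have "((\<lambda>h. w (x + h *\<^sub>R v x)) has_real_derivative D \<bullet> v x) (at 0)"
      by (simp add: has_field_derivative_def inner_commute mult.commute[of _ "D \<bullet> v x"] mult_commute_abs)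
    then have "((\<lambda>h. (w (x + h *\<^sub>R v x) - w x) / h) \<longlongrightarrow> D \<bullet> v x) (at 0)"
      by (simp add: DERIV_def)
    \<comment> \<open>The quotients are estimated for positive \<open>h\<close> only; the right-hand
      limit already determines the directional derivative.\<close>
    then have "((\<lambda>h. (w (x + h *\<^sub>R v x) - w x) / h) \<longlongrightarrow> D \<bullet> v x) (at_right 0)"
      by (rule tendsto_within_subset) simp
    moreover have "eventually (\<lambda>h. (w (x + h *\<^sub>R v x) - w x) / h \<le> \<eta> - V x) (at_right 0)"
      unfolding eventually_at_right_field using quot \<open>h1 > 0\<close> by auto
    ultimately show "D \<bullet> v x \<le> \<eta> - V x"
      by (rule tendsto_upperbound) simp
  qed
qed

section \<open>The semiflow of a locally Lipschitz vector field\<close>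

text \<open>A finite subcover of \<Omega> also covers a tube around \<Omega>, and monotonicity in
  \<open>b\<close> lets the largest of the finitely many constants serve for all points. It is
  applied to bounds on solutions and to attraction times.\<close>

lemma compact_locally_bounded_imp_uniform:
  fixes \<Omega> :: "'a::heine_borel set" and P :: "'a \<Rightarrow> real \<Rightarrow> bool"
  assumes "compact \<Omega>" "\<Omega> \<noteq> {}"
    and local: "\<And>x. x \<in> \<Omega> \<Longrightarrow> \<exists>\<delta>>0. \<exists>b. \<forall>y\<in>ball x \<delta>. P y b"
    and mono: "\<And>y b b'. P y b \<Longrightarrow> b \<le> b' \<Longrightarrow> P y b'"
  obtains \<rho> b where "\<rho> > 0" "\<And>y. infdist y \<Omega> \<le> \<rho> \<Longrightarrow> P y b"
proof -
  from local obtain \<delta> b where \<delta>: "\<And>x. x \<in> \<Omega> \<Longrightarrow> \<delta> x > 0"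
    and b: "\<And>x y. x \<in> \<Omega> \<Longrightarrow> y \<in> ball x (\<delta> x) \<Longrightarrow> P y (b x)"
    by metis
  obtain F where F: "F \<subseteq> \<Omega>" "finite F" "\<Omega> \<subseteq> (\<Union>x\<in>F. ball x (\<delta> x))"
    by (rule compactE_image[OF \<open>compact \<Omega>\<close>, of \<Omega> "\<lambda>x. ball x (\<delta> x)"]) (use \<delta> in auto)
  obtain \<rho> where \<rho>: "\<rho> > 0" "(\<Union>x\<in>\<Omega>. cball x \<rho>) \<subseteq> (\<Union>x\<in>F. ball x (\<delta> x))"
    using compact_subset_open_imp_cball_epsilon_subset[OF \<open>compact \<Omega>\<close> _ F(3)] by blast
  show ?thesis
  proof (rule that[OF \<rho>(1)])
    fix y assume "infdist y \<Omega> \<le> \<rho>"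
    moreover obtain z where "z \<in> \<Omega>" "infdist y \<Omega> = dist y z"
      using infdist_attains_inf[OF compact_imp_closed[OF \<open>compact \<Omega>\<close>] \<open>\<Omega> \<noteq> {}\<close>] by blast
    ultimately have "y \<in> (\<Union>x\<in>\<Omega>. cball x \<rho>)" by (auto simp: dist_commute)
    with \<rho>(2) obtain x where x: "x \<in> F" "y \<in> ball x (\<delta> x)" by blast
    then have "P y (b x)" using b F(1) by blast
    moreover have "b x \<le> Max (b ` F)" using x(1) F(2) by simp
    ultimately show "P y (Max (b ` F))" by (rule mono)
  qed
qed

locale lipschitz_semiflow =
  fixes f :: "real^'n \<Rightarrow> real^'n" and \<phi> :: "real^'n \<Rightarrow> real \<Rightarrow> real^'n"
  assumes lip: "local_lipschitz (UNIV :: real set) UNIV (\<lambda>_. f)"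
    and sol: "solution_map f \<phi>"
begin

lemma deriv: "t \<ge> 0 \<Longrightarrow> (\<phi> x has_vector_derivative f (\<phi> x t)) (at t within {0..})"
  and zero [simp]: "\<phi> x 0 = x"
  and semigroup: "s \<ge> 0 \<Longrightarrow> t \<ge> 0 \<Longrightarrow> \<phi> (\<phi> x t) s = \<phi> x (t + s)"
  using sol by (auto simp: solution_map_def)

lemma cont: "continuous_on {0..} (\<phi> x)"
  by (rule continuous_on_vector_derivative) (use deriv in auto)

lemma cont_Icc: "continuous_on {0..t} (\<phi> x)"
  by (rule continuous_on_subset[OF cont]) auto

lemma f_cont: "continuous_on S f"
  using local_lipschitz_continuous_on[OF lip, of 0] by (rule continuous_on_subset) auto

lemma f_lipschitz_on_compact:
  assumes "compact S"
  obtains K where "K-lipschitz_on S f"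
  by (rule local_lipschitz_compact_implies_lipschitz[OF local_lipschitz_subset[OF lip, of "{0}" S]
        assms compact_insert[OF compact_empty] continuous_on_const])
     (use that in auto)

text \<open>The squared distance \<open>q\<close> is differentiable even where it vanishes, and its
  derivative is at most \<open>2 * K * q\<close> by Cauchy-Schwarz. Hence
  \<open>exp (- (2 * K) * s) * q s\<close> does not increase.\<close>

lemma gronwall:
  assumes f: "K-lipschitz_on S f"
    and in_S: "\<And>s. s \<in> {0..t} \<Longrightarrow> \<phi> x s \<in> S" "\<And>s. s \<in> {0..t} \<Longrightarrow> \<phi> y s \<in> S"
    and "t \<ge> 0"
  shows "norm (\<phi> x t - \<phi> y t) \<le> exp (K * t) * norm (x - y)"
proof -
  define q where "q = (\<lambda>s. (\<phi> x s - \<phi> y s) \<bullet> (\<phi> x s - \<phi> y s))"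
  define g where "g = (\<lambda>s. exp (- (2 * K) * s) * q s)"
  have "g t \<le> g 0"
  proof (rule DERIV_nonpos_imp_decreasing_open[OF \<open>t \<ge> 0\<close>])
    show "continuous_on {0..t} g"
      unfolding g_def q_def by (intro continuous_intros cont_Icc)
    fix s assume s: "0 < s" "s < t"
    define d where "d = \<phi> x s - \<phi> y s"
    define e where "e = f (\<phi> x s) - f (\<phi> y s)"
    have "at s within {0..} = at s" using s by (intro at_within_interior) simp
    then have \<phi>: "(\<phi> z has_vector_derivative f (\<phi> z s)) (at s)" for z
      using deriv[of s z] s by simp
    have "((\<lambda>s. \<phi> x s - \<phi> y s) has_vector_derivative e) (at s)"
      unfolding e_def by (intro has_vector_derivative_diff \<phi>)
    then have "((\<lambda>s. \<phi> x s - \<phi> y s) has_derivative (\<lambda>h. h *\<^sub>R e)) (at s)"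
      unfolding has_vector_derivative_def .
    from has_derivative_inner[OF this this]
    have "(q has_derivative (\<lambda>h. h * (2 * (d \<bullet> e)))) (at s)"
      unfolding q_def by (rule has_derivative_eq_rhs) (simp add: d_def inner_commute mult.left_commute)
    then have q: "(q has_real_derivative (2 * (d \<bullet> e))) (at s)"
      by (simp add: has_field_derivative_def mult_commute_abs)
    have "(g has_real_derivative exp (- (2 * K) * s) * (2 * (d \<bullet> e - K * q s))) (at s)"
      unfolding g_def by (auto intro!: derivative_eq_intros q simp: algebra_simps)
    moreover have "q s = d \<bullet> d" by (simp add: q_def d_def)
    moreover have "d \<bullet> e \<le> K * (d \<bullet> d)"
    proof -
      have "norm e \<le> K * norm d"
        using lipschitz_onD[OF f in_S(1)[of s] in_S(2)[of s]] s by (simp add: dist_norm d_def e_def)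
      then have "norm d * norm e \<le> norm d * (K * norm d)" by (intro mult_left_mono) auto
      then show ?thesis
        using norm_cauchy_schwarz[of d e] by (simp add: dot_square_norm power2_eq_square algebra_simps)
    qed
    then have "exp (- (2 * K) * s) * (2 * (d \<bullet> e - K * (d \<bullet> d))) \<le> 0"
      by (intro mult_nonneg_nonpos) auto
    ultimately show "\<exists>y. (g has_real_derivative y) (at s) \<and> y \<le> 0" by auto
  qed
  then have "exp (- (2 * K * t)) * (norm (\<phi> x t - \<phi> y t))\<^sup>2 \<le> (norm (x - y))\<^sup>2"
    by (simp add: g_def q_def power2_norm_eq_inner)
  moreover have "exp (- (2 * K * t)) = 1 / (exp (K * t))\<^sup>2"
    by (simp add: exp_minus divide_inverse mult.assoc flip: exp_of_nat_mult)
  ultimately have "(norm (\<phi> x t - \<phi> y t))\<^sup>2 / (exp (K * t))\<^sup>2 \<le> (norm (x - y))\<^sup>2" by simp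
  then have "(norm (\<phi> x t - \<phi> y t))\<^sup>2 \<le> (exp (K * t) * norm (x - y))\<^sup>2"
    by (simp add: power_mult_distrib divide_le_eq mult.commute)
  then show ?thesis by (rule power2_le_imp_le) simp
qed

text \<open>Up to the first time at which the perturbed solution leaves a bounded tube, Gronwall's
  estimate applies, and it keeps the solution strictly inside the tube.\<close>
lemma locally_bounded:
  assumes "t \<ge> 0"
  shows "\<exists>\<delta>>0. \<exists>b. \<forall>y\<in>ball x \<delta>. \<forall>s\<in>{0..t}. norm (\<phi> y s) \<le> b"
proof -
  have "bounded (\<phi> x ` {0..t})"
    by (intro compact_imp_bounded compact_continuous_image cont_Icc) simp
  then obtain b where b: "\<And>s. s \<in> {0..t} \<Longrightarrow> norm (\<phi> x s) \<le> b"
    unfolding bounded_iff by blast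
  obtain K where K: "K-lipschitz_on (cball 0 (b + 1)) f"
    using f_lipschitz_on_compact[OF compact_cball] by blast
  have "K \<ge> 0" using K by (rule lipschitz_on_nonneg)
  \<comment> \<open>The initial distance is below \<open>exp (- K * t)\<close>, so Gronwall growth
    by at most \<open>exp (K * t)\<close> keeps the deviation below 1, the width of the
    tube.\<close>
  have "norm (\<phi> y s) \<le> b + 1" if y: "y \<in> ball x (exp (- K * t))" and s: "s \<in> {0..t}" for y s
  proof (rule ccontr)
    let ?X = "{u \<in> {0..t}. b + 1 \<le> norm (\<phi> y u)}"
    assume "\<not> norm (\<phi> y s) \<le> b + 1"
    then have "?X \<noteq> {}" using s by auto
    moreover have "closed ?X"
      by (intro continuous_on_closed_Collect_le continuous_intros cont_Icc closed_atLeastAtMost)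
    then have "compact ?X"
      unfolding compact_eq_bounded_closed by (auto intro: bounded_subset[OF bounded_closed_interval[of 0 t]])
    ultimately obtain u where u: "u \<in> ?X" "\<And>v. v \<in> ?X \<Longrightarrow> u \<le> v"
      using compact_attains_inf[of ?X] by blast
    have before: "norm (\<phi> y v) \<le> b + 1" if "0 \<le> v" "v < u" for v
      using u that by force
    have "u > 0"
    proof (rule ccontr)
      assume "\<not> u > 0"
      then have "b + 1 \<le> norm y" using u(1) by auto
      moreover have "norm x \<le> b" using b[of 0] assms by simp
      moreover have "exp (- K * t) \<le> 1" using \<open>K \<ge> 0\<close> assms by simp
      moreover have "norm (y - x) < exp (- K * t)" using y by (simp add: dist_norm norm_minus_commute)
      ultimately show False using norm_triangle_ineq2[of y x] by linarith
    qed
    have at_u: "norm (\<phi> y u) \<le> b + 1"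
    proof (rule continuous_le_on_closure[where S = "{0..<u}" and f = "\<lambda>v. norm (\<phi> y v)"])
      show "continuous_on (closure {0..<u}) (\<lambda>v. norm (\<phi> y v))"
        using \<open>u > 0\<close> by (simp add: closure_atLeastLessThan) (intro continuous_intros cont_Icc)
      show "u \<in> closure {0..<u}" using \<open>u > 0\<close> by (simp add: closure_atLeastLessThan)
    qed (use before in auto)
    have "norm (\<phi> x u - \<phi> y u) \<le> exp (K * u) * norm (x - y)"
    proof (rule gronwall[OF K])
      fix v assume "v \<in> {0..u}"
      then show "\<phi> x v \<in> cball 0 (b + 1)" "\<phi> y v \<in> cball 0 (b + 1)"
        using u(1) b[of v] before[of v] at_u by (auto simp: less_le)
    qed (use \<open>u > 0\<close> in simp)
    also have "\<dots> < exp (K * u) * exp (- K * t)" using y by (simp add: dist_norm)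
    also have "\<dots> \<le> 1"
      using u(1) \<open>K \<ge> 0\<close> by (simp add: mult_left_mono flip: exp_add)
    finally have "norm (\<phi> y u) < b + 1"
      using b[of u] u(1) norm_triangle_ineq3[of "\<phi> x u" "\<phi> y u"] by auto
    with u(1) show False by simp
  qed
  then show ?thesis by (intro exI[of _ "exp (- K * t)"] exI[of _ "b + 1"] conjI) auto
qed

lemma bounded_on_compact:
  assumes "compact S" "t \<ge> 0"
  obtains b where "b \<ge> 0" "\<And>y s. y \<in> S \<Longrightarrow> s \<in> {0..t} \<Longrightarrow> norm (\<phi> y s) \<le> b"
proof (cases "S = {}")
  case False
  from compact_locally_bounded_imp_uniform[OF assms(1) False,
      where P = "\<lambda>y b. \<forall>s\<in>{0..t}. norm (\<phi> y s) \<le> b"] locally_bounded[OF assms(2)]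
  obtain \<rho> b where "\<rho> > 0" and b: "\<And>y. infdist y S \<le> \<rho> \<Longrightarrow> \<forall>s\<in>{0..t}. norm (\<phi> y s) \<le> b"
    by (smt (verit))
  show ?thesis
    by (rule that[of "max 0 b"]) (use b \<open>\<rho> > 0\<close> in \<open>force intro: max.coboundedI2\<close>)+
qed (use that[of 0] in auto)

text \<open>All solutions from \<open>S\<close> stay in one ball up to time \<open>t\<close>, so a
  single Lipschitz constant of \<open>f\<close> serves Gronwall's estimate.\<close>

lemma lipschitz_on_compact:
  assumes "compact S" "t \<ge> 0"
  obtains K where "K \<ge> 0"
    "\<And>x y s. x \<in> S \<Longrightarrow> y \<in> S \<Longrightarrow> s \<in> {0..t} \<Longrightarrow> norm (\<phi> x s - \<phi> y s) \<le> exp (K * s) * norm (x - y)"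
proof -
  obtain b where b: "\<And>y s. y \<in> S \<Longrightarrow> s \<in> {0..t} \<Longrightarrow> norm (\<phi> y s) \<le> b"
    using bounded_on_compact[OF assms] by blast
  obtain K where K: "K-lipschitz_on (cball 0 b) f"
    using f_lipschitz_on_compact[OF compact_cball] by blast
  show ?thesis
    by (rule that[OF lipschitz_on_nonneg[OF K]], rule gronwall[OF K]) (use b in auto)
qed

lemma continuous_initial:
  assumes "t \<ge> 0"
  shows "isCont (\<lambda>x. \<phi> x t) x"
proof -
  obtain K where K: "\<And>y z s. y \<in> cball x 1 \<Longrightarrow> z \<in> cball x 1 \<Longrightarrow> s \<in> {0..t} \<Longrightarrow>
      norm (\<phi> y s - \<phi> z s) \<le> exp (K * s) * norm (y - z)"
    using lipschitz_on_compact[OF compact_cball assms] by blast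
  have "(exp (K * t))-lipschitz_on (cball x 1) (\<lambda>y. \<phi> y t)"
    using K[of _ _ t] assms by (intro lipschitz_onI) (auto simp: dist_norm)
  then have "continuous_on (ball x 1) (\<lambda>y. \<phi> y t)"
    by (rule continuous_on_subset[OF lipschitz_on_continuous_on]) auto
  then show ?thesis
    by (simp add: continuous_on_eq_continuous_at)
qed

text \<open>A solution starting in \<Omega> reaches the \<delta>-neighbourhood of \<open>A\<close>
  given by stability at some time \<open>s\<close>. By continuous dependence nearby solutions are
  there at the same time, and stability keeps them within \<open>e\<close> forever after.
  Compactness makes the time uniform.\<close>

lemma uniform_attraction:
  assumes A: "attractor_set \<phi> A" and "compact \<Omega>" "\<Omega> \<noteq> {}"
    and basin: "\<Omega> \<subseteq> basin_of_attraction \<phi> A" and "e > 0"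
  obtains \<rho> T where "\<rho> > 0" "\<And>y t. infdist y \<Omega> \<le> \<rho> \<Longrightarrow> t \<ge> T \<Longrightarrow> infdist (\<phi> y t) A < e"
proof -
  have "closed A" "A \<noteq> {}" using A by (auto simp: attractor_set_def compact_imp_closed)
  obtain \<delta> where "\<delta> > 0" and \<delta>: "\<And>x t. x \<in> (\<Union>a\<in>A. ball a \<delta>) \<Longrightarrow> t \<ge> 0 \<Longrightarrow> infdist (\<phi> x t) A < e"
    using A \<open>e > 0\<close> unfolding attractor_set_def by meson
  have "\<exists>r>0. \<exists>T. \<forall>y\<in>ball x r. \<forall>t\<ge>T. infdist (\<phi> y t) A < e" if "x \<in> \<Omega>" for x
  proof -
    have "((\<lambda>t. infdist (\<phi> x t) A) \<longlongrightarrow> 0) at_top"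
      using that basin by (auto simp: basin_of_attraction_def)
    then have "eventually (\<lambda>t. infdist (\<phi> x t) A < \<delta>) at_top"
      using \<open>\<delta> > 0\<close> by (rule order_tendstoD)
    then have "eventually (\<lambda>t. infdist (\<phi> x t) A < \<delta> \<and> t \<ge> 0) at_top"
      using eventually_ge_at_top[of 0] by (rule eventually_conj)
    then obtain s where s: "infdist (\<phi> x s) A < \<delta>" "s \<ge> 0"
      unfolding eventually_at_top_linorder by blast
    obtain a where "a \<in> A" "infdist (\<phi> x s) A = dist (\<phi> x s) a"
      using infdist_attains_inf[OF \<open>closed A\<close> \<open>A \<noteq> {}\<close>] by blast
    with s have "\<phi> x s \<in> (\<Union>a\<in>A. ball a \<delta>)" by (auto simp: dist_commute)
    then have "eventually (\<lambda>y. \<phi> y s \<in> (\<Union>a\<in>A. ball a \<delta>)) (nhds x)"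
      using continuous_initial[OF s(2), of x, unfolded isCont_def, THEN tendsto_at_iff_tendsto_nhds[THEN iffD1]]
      by (intro eventually_compose_filterlim[OF eventually_nhds_in_open]) auto
    then obtain r where "r > 0" and r: "\<And>y. y \<in> ball x r \<Longrightarrow> \<phi> y s \<in> (\<Union>a\<in>A. ball a \<delta>)"
      unfolding eventually_nhds_metric by (auto simp: dist_commute)
    have "infdist (\<phi> y t) A < e" if "y \<in> ball x r" "t \<ge> s" for y t
      using \<delta>[OF r[OF that(1)], of "t - s"] semigroup[of "t - s" s y] that(2) s(2) by simp
    with \<open>r > 0\<close> show ?thesis by blast
  qed
  from compact_locally_bounded_imp_uniform[OF \<open>compact \<Omega>\<close> \<open>\<Omega> \<noteq> {}\<close>,
      where P = "\<lambda>y T. \<forall>t\<ge>T. infdist (\<phi> y t) A < e", OF this]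
  show ?thesis using that by (smt (verit))
qed

section \<open>Lyapunov functions that decay along Euler steps\<close>

text \<open>Within time \<open>h\<close> the solution moves by O(h), so its velocity differs from
  \<open>f y\<close> by O(h), which integrates to a quadratic error.\<close>

lemma euler_step_error:
  assumes K: "K-lipschitz_on (cball 0 b) f" and M: "\<And>z. z \<in> cball 0 b \<Longrightarrow> norm (f z) \<le> M"
    and \<phi>: "\<And>u. u \<in> {0..h} \<Longrightarrow> norm (\<phi> y u) \<le> b" and "0 \<le> h"
  shows "norm (\<phi> y h - (y + h *\<^sub>R f y)) \<le> 3 * K * M * h\<^sup>2"
proof -
  have "K \<ge> 0" using K by (rule lipschitz_on_nonneg)
  have der: "(\<phi> y has_vector_derivative f (\<phi> y u)) (at u within {0..s})" if "u \<in> {0..s}" for u s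
    using that by (intro has_vector_derivative_within_subset[OF deriv]) auto
  have in_ball: "\<phi> y u \<in> cball 0 b" if "u \<in> {0..h}" for u using \<phi>[OF that] by simp
  have y: "y \<in> cball 0 b" using in_ball[of 0] \<open>0 \<le> h\<close> by simp
  \<comment> \<open>The factor 3 is \<open>M\<close> for the Euler step plus \<open>2 * M\<close>
    for the crude bound on the variation of the velocity.\<close>
  have disp: "norm (\<phi> y s - y) \<le> 3 * M * s" if s: "s \<in> {0..h}" for s
  proof -
    have "norm (\<phi> y s - \<phi> y 0 - (s - 0) *\<^sub>R f (\<phi> y 0)) \<le> norm (s - 0) * (M + M)"
    proof (rule vector_differentiable_bound_linearization[where S = "{0..s}" and f' = "\<lambda>u. f (\<phi> y u)"])
      fix u assume "u \<in> {0..s}"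
      then show "norm (f (\<phi> y u) - f (\<phi> y 0)) \<le> M + M"
        using s M[OF in_ball[of u]] M[OF y] by (intro norm_diff_triangle_le[of _ 0, simplified] norm_triangle_le_diff) auto
    qed (use s der in \<open>auto simp: closed_segment_eq_real_ivl\<close>)
    then have "norm (\<phi> y s - y - s *\<^sub>R f y) \<le> s * (M + M)" using s by simp
    moreover have "norm (s *\<^sub>R f y) \<le> s * M" using s M[OF y] by (simp add: mult_left_mono)
    ultimately show ?thesis
      using norm_triangle_ineq[of "\<phi> y s - y - s *\<^sub>R f y" "s *\<^sub>R f y"] by (simp add: algebra_simps)
  qed
  have "norm (\<phi> y h - \<phi> y 0 - (h - 0) *\<^sub>R f (\<phi> y 0)) \<le> norm (h - 0) * (K * (3 * M * h))"
  proof (rule vector_differentiable_bound_linearization[where S = "{0..h}" and f' = "\<lambda>u. f (\<phi> y u)"])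
    fix u assume u: "u \<in> {0..h}"
    have "0 \<le> M" using M[OF y] norm_ge_zero[of "f y"] by linarith
    have "norm (f (\<phi> y u) - f y) \<le> K * norm (\<phi> y u - y)"
      using lipschitz_onD[OF K in_ball[OF u] y] by (simp add: dist_norm)
    also have "\<dots> \<le> K * (3 * M * u)" using disp[OF u] \<open>K \<ge> 0\<close> by (rule mult_left_mono)
    also have "\<dots> \<le> K * (3 * M * h)" using u \<open>K \<ge> 0\<close> \<open>0 \<le> M\<close> by (intro mult_left_mono) auto
    finally show "norm (f (\<phi> y u) - f (\<phi> y 0)) \<le> K * (3 * M * h)" by simp
  qed (use \<open>0 \<le> h\<close> der in \<open>auto simp: closed_segment_eq_real_ivl\<close>)
  then show ?thesis using \<open>0 \<le> h\<close> by (simp add: power2_eq_square algebra_simps)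
qed

lemma lyapunov_function:
  assumes A: "attractor_set \<phi> A" and \<Omega>: "compact \<Omega>" "A \<subseteq> \<Omega>" "\<Omega> \<subseteq> basin_of_attraction \<phi> A"
    and "e > 0"
  obtains V :: "real^'n \<Rightarrow> real" and L r M where
    "L-lipschitz_on UNIV V" "\<And>y. norm y > r \<Longrightarrow> V y = 0"
    "0 \<le> r" "0 \<le> M" "\<And>x. x \<in> \<Omega> \<Longrightarrow> norm x \<le> r" "\<And>x. x \<in> \<Omega> \<Longrightarrow> norm (f x) \<le> M"
    "\<And>\<kappa>. \<kappa> > 0 \<Longrightarrow> \<exists>\<delta>>0. \<exists>h0>0. \<forall>x\<in>\<Omega>. \<forall>y\<in>ball x \<delta>. \<forall>h. 0 < h \<and> h < h0 \<longrightarrow>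
       V (y + h *\<^sub>R f x) - V y \<le> h * (\<kappa> - V x)"
    "\<And>x. x \<in> \<Omega> \<Longrightarrow> 0 \<le> V x" "\<And>x. x \<in> \<Omega> \<Longrightarrow> infdist x A - e \<le> V x" "\<And>x. x \<in> A \<Longrightarrow> V x = 0"
proof -
  have inv: "\<phi> x t \<in> A" if "x \<in> A" "t \<ge> 0" for x t
    using A that by (auto simp: attractor_set_def)
  have "\<Omega> \<noteq> {}" using A \<Omega> by (auto simp: attractor_set_def)
  obtain \<rho> T0 where "\<rho> > 0" and T0: "\<And>y t. infdist y \<Omega> \<le> \<rho> \<Longrightarrow> t \<ge> T0 \<Longrightarrow> infdist (\<phi> y t) A < e"
    using uniform_attraction[OF A \<Omega>(1) \<open>\<Omega> \<noteq> {}\<close> \<Omega>(3) \<open>e > 0\<close>] by blast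
  define T where "T = max 1 T0"
  \<comment> \<open>The estimates on \<open>W\<close> are proved on a compact tube, because
    mollification evaluates the Lyapunov function near \<Omega> and not just on it.\<close>
  define C where "C = {y. infdist y \<Omega> \<le> \<rho>}"
  have "T \<ge> 1" by (simp add: T_def)
  have T: "infdist (\<phi> y t) A < e" if "y \<in> C" "t \<ge> T" for y t
    using T0 that by (auto simp: C_def T_def)
  have "compact C" unfolding C_def by (rule compact_infdist_le[OF \<open>\<Omega> \<noteq> {}\<close> \<Omega>(1) \<open>\<rho> > 0\<close>])
  have "\<Omega> \<subseteq> C" using \<open>\<rho> > 0\<close> by (auto simp: C_def)

  define G where "G = (\<lambda>x t. exp t * max 0 (infdist (\<phi> x t) A - e))"
  define W where "W = (\<lambda>x. SUP t\<in>{0..T}. G x t)"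
  have bdd: "bdd_above (G x ` {0..T})" for x
  proof -
    have "continuous_on {0..T} (G x)"
      unfolding G_def by (intro continuous_intros cont_Icc)
    then have "compact (G x ` {0..T})" by (rule compact_continuous_image) simp
    then show ?thesis by (intro bounded_imp_bdd_above compact_imp_bounded)
  qed
  have ne: "{0..T} \<noteq> {}" using \<open>T \<ge> 1\<close> by simp
  have G_le: "G x t \<le> W x" if "t \<in> {0..T}" for x t
    unfolding W_def using that bdd by (rule cSUP_upper)
  have W_le: "W x \<le> c" if "\<And>t. t \<in> {0..T} \<Longrightarrow> G x t \<le> c" for x c
    unfolding W_def by (rule cSUP_least[OF ne that])
  have W0: "max 0 (infdist x A - e) \<le> W x" for x
    using G_le[of 0 x] \<open>T \<ge> 1\<close> by (simp add: G_def)
  then have W_nonneg: "0 \<le> W x" for x by (meson max.boundedE)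
  have W_A: "W x = 0" if "x \<in> A" for x
  proof (rule antisym[OF W_le W_nonneg])
    show "G x t \<le> 0" if "t \<in> {0..T}" for t
      using inv[OF \<open>x \<in> A\<close>, of t] that \<open>e > 0\<close> by (simp add: G_def)
  qed
  \<comment> \<open>The weight \<open>exp t\<close> turns a time shift by \<open>s\<close> into the
    factor \<open>exp (- s)\<close>. Times \<open>s + t\<close> beyond \<open>T\<close> contribute
    0, as the solution is then already within \<open>e\<close> of \<open>A\<close>.\<close>
  have W_flow: "W (\<phi> x s) \<le> exp (- s) * W x" if "x \<in> C" "s \<ge> 0" for x s
  proof (rule W_le)
    fix t assume t: "t \<in> {0..T}"
    have eq: "G (\<phi> x s) t = exp (- s) * G x (s + t)"
      using semigroup[of t s x] t that(2) by (simp add: G_def exp_add exp_minus)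
    have "G x (s + t) \<le> W x"
    proof (cases "s + t \<le> T")
      case False
      then have "G x (s + t) = 0" using T[OF that(1), of "s + t"] by (simp add: G_def)
      then show ?thesis using W_nonneg by simp
    qed (use G_le t that(2) in auto)
    then show "G (\<phi> x s) t \<le> exp (- s) * W x" unfolding eq by simp
  qed
  have "T \<ge> 0" using \<open>T \<ge> 1\<close> by simp
  obtain K0 where "K0 \<ge> 0" and K0: "\<And>x y s. x \<in> C \<Longrightarrow> y \<in> C \<Longrightarrow> s \<in> {0..T} \<Longrightarrow>
      norm (\<phi> x s - \<phi> y s) \<le> exp (K0 * s) * norm (x - y)"
    using lipschitz_on_compact[OF \<open>compact C\<close> \<open>T \<ge> 0\<close>] by blast
  define L0 where "L0 = exp T * exp (K0 * T)"
  have "L0 > 0" by (simp add: L0_def)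
  have W_diff: "W x - W y \<le> L0 * norm (x - y)" if "x \<in> C" "y \<in> C" for x y
  proof -
    have "W x \<le> W y + L0 * norm (x - y)"
    proof (rule W_le)
      fix t assume t: "t \<in> {0..T}"
      have "infdist (\<phi> x t) A - infdist (\<phi> y t) A \<le> norm (\<phi> x t - \<phi> y t)"
        using infdist_triangle_abs[of "\<phi> x t" A "\<phi> y t"] by (simp add: dist_norm)
      also have "\<dots> \<le> exp (K0 * t) * norm (x - y)" by (rule K0[OF that t])
      also have "\<dots> \<le> exp (K0 * T) * norm (x - y)"
        using t \<open>K0 \<ge> 0\<close> by (intro mult_right_mono) (auto intro: mult_left_mono)
      finally have "max 0 (infdist (\<phi> x t) A - e) \<le> max 0 (infdist (\<phi> y t) A - e) + exp (K0 * T) * norm (x - y)"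
        using zero_le_mult_iff[of "exp (K0 * T)" "norm (x - y)"] by auto
      then have "G x t \<le> exp t * (max 0 (infdist (\<phi> y t) A - e) + exp (K0 * T) * norm (x - y))"
        unfolding G_def by (rule mult_left_mono) simp
      also have "\<dots> = G y t + exp t * (exp (K0 * T) * norm (x - y))"
        by (simp add: G_def algebra_simps)
      also have "\<dots> \<le> W y + exp T * (exp (K0 * T) * norm (x - y))"
        using t by (intro add_mono G_le mult_right_mono) auto
      finally show "G x t \<le> W y + L0 * norm (x - y)" by (simp add: L0_def mult.assoc)
    qed
    then show ?thesis by simp
  qed
  obtain b where b: "0 \<le> b" "\<And>x. x \<in> C \<Longrightarrow> W x \<le> b"
  proof -
    have "L0-lipschitz_on C W"
    proof (rule lipschitz_onI)
      show "dist (W x) (W y) \<le> L0 * dist x y" if "x \<in> C" "y \<in> C" for x y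
        using W_diff[of x y] W_diff[of y x] that by (simp add: dist_norm norm_minus_commute abs_le_iff)
    qed (use \<open>L0 > 0\<close> in simp)
    then have "compact (W ` C)"
      by (intro compact_continuous_image lipschitz_on_continuous_on \<open>compact C\<close>)
    then obtain b where "\<forall>y\<in>W ` C. norm y \<le> b"
      using compact_imp_bounded bounded_iff by metis
    then show ?thesis using that[of "max 0 b"] by force
  qed

  \<comment> \<open>This cutoff is 1 up to distance \<rho>/2 from \<Omega> and 0 from distance
    \<rho> on; it makes \<open>V\<close> globally Lipschitz with compact support.\<close>
  define \<theta> where "\<theta> = (\<lambda>x. max 0 (min 1 (2 - 2 / \<rho> * infdist x \<Omega>)))"
  define V where "V = (\<lambda>x. \<theta> x * W x)"
  have \<theta>_bounds: "0 \<le> \<theta> x" "\<theta> x \<le> 1" for x by (auto simp: \<theta>_def)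
  have \<theta>_one: "\<theta> x = 1" if "infdist x \<Omega> \<le> \<rho> / 2" for x
    using that \<open>\<rho> > 0\<close> by (simp add: \<theta>_def field_simps)
  have \<theta>_zero: "\<theta> x = 0" if "x \<notin> C" for x
    using that \<open>\<rho> > 0\<close> by (simp add: \<theta>_def C_def field_simps)
  have \<theta>_diff: "\<theta> x - \<theta> y \<le> 2 / \<rho> * norm (x - y)" for x y
  proof -
    have "2 / \<rho> * (infdist y \<Omega> - infdist x \<Omega>) \<le> 2 / \<rho> * norm (x - y)"
      using infdist_triangle_abs[of x \<Omega> y] \<open>\<rho> > 0\<close> by (intro mult_left_mono) (auto simp: dist_norm)
    moreover have "0 \<le> 2 / \<rho> * norm (x - y)" using \<open>\<rho> > 0\<close> by simp
    ultimately show ?thesis unfolding \<theta>_def right_diff_distrib by linarith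
  qed
  have V_W: "V x = W x" if "infdist x \<Omega> \<le> \<rho> / 2" for x
    using \<theta>_one[OF that] by (simp add: V_def)
  have V_le_W: "V x \<le> W x" for x
    using mult_right_mono[OF \<theta>_bounds(2) W_nonneg] by (simp add: V_def)
  have V_nonneg: "0 \<le> V x" for x using \<theta>_bounds W_nonneg by (simp add: V_def)
  define L where "L = L0 + 2 / \<rho> * b"
  have "L \<ge> 0" using \<open>L0 > 0\<close> \<open>\<rho> > 0\<close> b(1) by (simp add: L_def)
  have V_diff: "V x - V y \<le> L * norm (x - y)" for x y
  proof (cases "x \<in> C")
    case False
    then have "V x = 0" by (simp add: V_def \<theta>_zero)
    then show ?thesis using V_nonneg[of y] \<open>L \<ge> 0\<close> by (smt (verit) mult_nonneg_nonneg norm_ge_zero)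
  next
    case True
    have "(\<theta> x - \<theta> y) * W x \<le> (2 / \<rho> * norm (x - y)) * b"
      by (rule order_trans[OF mult_right_mono[OF \<theta>_diff W_nonneg] mult_left_mono[OF b(2)[OF True]]])
        (use \<open>\<rho> > 0\<close> in simp)
    moreover have "\<theta> y * (W x - W y) \<le> L0 * norm (x - y)"
    proof (cases "y \<in> C")
      case True
      have "\<theta> y * (W x - W y) \<le> \<theta> y * (L0 * norm (x - y))"
        by (intro mult_left_mono W_diff \<open>x \<in> C\<close> True \<theta>_bounds)
      also have "\<dots> \<le> 1 * (L0 * norm (x - y))"
        using \<open>L0 > 0\<close> by (intro mult_right_mono \<theta>_bounds) simp
      finally show ?thesis by simp
    qed (use \<theta>_zero \<open>L0 > 0\<close> in simp)
    ultimately show ?thesis by (simp add: V_def L_def algebra_simps)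
  qed
  have V_lip: "L-lipschitz_on UNIV V"
  proof (rule lipschitz_onI)
    show "dist (V x) (V y) \<le> L * dist x y" for x y
      using V_diff[of x y] V_diff[of y x] by (simp add: dist_norm norm_minus_commute abs_le_iff)
  qed fact

  obtain B where B: "B \<ge> 0" "\<And>y s. y \<in> C \<Longrightarrow> s \<in> {0..T} \<Longrightarrow> norm (\<phi> y s) \<le> B"
    using bounded_on_compact[OF \<open>compact C\<close> \<open>T \<ge> 0\<close>] by blast
  have C_B: "norm y \<le> B" if "y \<in> C" for y using B(2)[OF that, of 0] \<open>T \<ge> 0\<close> by simp
  obtain K where K: "K-lipschitz_on (cball 0 B) f"
    using f_lipschitz_on_compact[OF compact_cball] by blast
  have "K \<ge> 0" using K by (rule lipschitz_on_nonneg)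
  obtain M where M: "M > 0" "\<And>z. z \<in> cball 0 B \<Longrightarrow> norm (f z) \<le> M"
  proof -
    have "bounded (f ` cball 0 B)"
      by (intro compact_imp_bounded compact_continuous_image f_cont compact_cball)
    then show ?thesis using that unfolding bounded_pos by blast
  qed

  have decay: "\<exists>\<delta>>0. \<exists>h0>0. \<forall>x\<in>\<Omega>. \<forall>y\<in>ball x \<delta>. \<forall>h. 0 < h \<and> h < h0 \<longrightarrow>
       V (y + h *\<^sub>R f x) - V y \<le> h * (\<kappa> - V x)" if "\<kappa> > 0" for \<kappa>
  proof -
    \<comment> \<open>In the estimate below, \<open>p\<close> collects the coefficients of
      \<open>h * \<delta>\<close> and \<open>q\<close> those of \<open>h\<^sup>2\<close>; \<delta>
      and \<open>h0\<close> make each contribution at most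
      \<open>h * (\<kappa> / 2)\<close>.\<close>
    define p where "p = L + L * K"
    define q where "q = b + 3 * L * K * M"
    have pq: "p \<ge> 0" "q \<ge> 0"
      using \<open>L \<ge> 0\<close> \<open>K \<ge> 0\<close> b(1) M(1) by (simp_all add: p_def q_def)
    define \<delta> where "\<delta> = min (\<rho> / 2) (\<kappa> / (2 * (p + 1)))"
    define h0 where "h0 = min 1 (\<kappa> / (2 * (q + 1)))"
    have small: "c * d \<le> \<kappa> / 2" if "d \<le> \<kappa> / (2 * (c + 1))" "c \<ge> 0" for c d
    proof -
      have "c * d \<le> c * (\<kappa> / (2 * (c + 1)))" using that by (intro mult_left_mono)
      also have "\<dots> \<le> \<kappa> / 2" using \<open>c \<ge> 0\<close> \<open>\<kappa> > 0\<close> by (simp add: field_simps)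
      finally show ?thesis .
    qed
    have "V (y + h *\<^sub>R f x) - V y \<le> h * (\<kappa> - V x)"
      if "x \<in> \<Omega>" and y: "y \<in> ball x \<delta>" and h: "0 < h" "h < h0" for x y h
    proof -
      have xy: "norm (x - y) \<le> \<delta>" using y by (simp add: dist_norm)
      have "infdist y \<Omega> \<le> \<rho> / 2"
        using infdist_le[OF \<open>x \<in> \<Omega>\<close>, of y] y by (simp add: \<delta>_def dist_commute)
      then have "V y = W y" and "y \<in> C" using V_W \<open>\<rho> > 0\<close> by (auto simp: C_def)
      have "x \<in> C" using \<open>x \<in> \<Omega>\<close> \<open>\<Omega> \<subseteq> C\<close> by blast
      have hT: "h \<le> 1" "h \<le> T" using h \<open>T \<ge> 1\<close> by (auto simp: h0_def)
      have "norm (y + h *\<^sub>R f x - \<phi> y h) \<le> h * (K * \<delta>) + 3 * K * M * h\<^sup>2"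
      proof -
        have "norm (f x - f y) \<le> K * norm (x - y)"
          using lipschitz_onD[OF K, of x y] C_B \<open>x \<in> C\<close> \<open>y \<in> C\<close> by (simp add: dist_norm)
        also have "\<dots> \<le> K * \<delta>" using xy \<open>K \<ge> 0\<close> by (rule mult_left_mono)
        finally have "norm (h *\<^sub>R (f x - f y)) \<le> h * (K * \<delta>)" using h by simp
        moreover have "norm (\<phi> y h - (y + h *\<^sub>R f y)) \<le> 3 * K * M * h\<^sup>2"
          by (rule euler_step_error[OF K M(2)]) (use h hT B(2)[OF \<open>y \<in> C\<close>] in auto)
        moreover have "y + h *\<^sub>R f x - \<phi> y h = h *\<^sub>R (f x - f y) - (\<phi> y h - (y + h *\<^sub>R f y))"
          by (simp add: algebra_simps)
        ultimately show ?thesis by (simp only:) (rule order_trans[OF norm_triangle_ineq4 add_mono])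
      qed
      then have "L * norm (y + h *\<^sub>R f x - \<phi> y h) \<le> L * (h * (K * \<delta>) + 3 * K * M * h\<^sup>2)"
        using \<open>L \<ge> 0\<close> by (rule mult_left_mono)
      then have "V (y + h *\<^sub>R f x) - V (\<phi> y h) \<le> L * (h * (K * \<delta>) + 3 * K * M * h\<^sup>2)"
        using V_diff order_trans by blast
      \<comment> \<open>The solution may leave the region where \<open>V\<close> and
        \<open>W\<close> agree, so only \<open>V \<le> W\<close> is used at
        \<open>\<phi> y h\<close>, and equality at \<open>y\<close>.\<close>
      moreover have "V (\<phi> y h) \<le> (1 - h + h\<^sup>2) * V y"
      proof -
        \<comment> \<open>The product \<open>(1 + h) * (1 - h + h\<^sup>2)\<close> is
          \<open>1 + h ^ 3\<close>; with \<open>1 + h \<le> exp h\<close> this bounds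
          \<open>exp (- h)\<close> by \<open>1 - h + h\<^sup>2\<close>.\<close>
        have "exp (- h) * 1 \<le> exp (- h) * ((1 + h) * (1 - h + h\<^sup>2))"
          using h by (intro mult_left_mono) (auto simp: algebra_simps power2_eq_square)
        also have "\<dots> \<le> 1 * (1 - h + h\<^sup>2)"
        proof -
          have "exp (- h) * (1 + h) \<le> exp (- h) * exp h"
            using exp_ge_add_one_self[of h] by (intro mult_left_mono) auto
          also have "\<dots> = 1" by (simp flip: exp_add)
          finally show ?thesis
            unfolding mult.assoc[symmetric] using hT by (intro mult_right_mono) auto
        qed
        finally have "exp (- h) * W y \<le> (1 - h + h\<^sup>2) * W y"
          using W_nonneg by (intro mult_right_mono) auto
        moreover have "V (\<phi> y h) \<le> exp (- h) * W y"
          using V_le_W[of "\<phi> y h"] W_flow[OF \<open>y \<in> C\<close>, of h] h by linarith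
        ultimately show ?thesis using \<open>V y = W y\<close> by simp
      qed
      moreover have "h * V x \<le> h * (V y + L * \<delta>)"
        using V_diff[of x y] mult_left_mono[OF xy \<open>L \<ge> 0\<close>] h by (intro mult_left_mono) auto
      moreover have "h\<^sup>2 * V y \<le> h\<^sup>2 * b"
        using b(2)[OF \<open>y \<in> C\<close>] \<open>V y = W y\<close> by (intro mult_left_mono) auto
      ultimately have "V (y + h *\<^sub>R f x) - V y \<le> h * (p * \<delta> + q * h - V x)"
        by (simp add: p_def q_def algebra_simps power2_eq_square)
      also have "\<dots> \<le> h * (\<kappa> - V x)"
        using small[of \<delta> p] small[of h q] pq h by (intro mult_left_mono) (auto simp: \<delta>_def h0_def)
      finally show ?thesis .
    qed
    moreover have "\<delta> > 0" "h0 > 0" using \<open>\<rho> > 0\<close> \<open>\<kappa> > 0\<close> pq by (auto simp: \<delta>_def h0_def)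
    ultimately show ?thesis by blast
  qed
  have near_\<Omega>: "V x = W x" if "x \<in> \<Omega>" for x using that V_W \<open>\<rho> > 0\<close> by simp
  show thesis
  proof (rule that[OF V_lip _ B(1) _ _ _ decay])
    show "V y = 0" if "B < norm y" for y
      using that C_B[of y] by (cases "y \<in> C") (auto simp: V_def \<theta>_zero)
    show "0 \<le> M" using M by simp
    show "norm x \<le> B" "norm (f x) \<le> M" if "x \<in> \<Omega>" for x
      using that \<open>\<Omega> \<subseteq> C\<close> C_B M(2) by auto
    show "0 \<le> V x" "infdist x A - e \<le> V x" if "x \<in> \<Omega>" for x
      using V_nonneg near_\<Omega>[OF that] W0[of x] by auto
    show "V x = 0" if "x \<in> A" for x
      using that W_A by (simp add: V_def)
  qed
qed

end

section \<open>Sums of squares\<close>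

text \<open>As \<open>gradient\<close> is a definite description, a gradient vector must be
  exhibited: the Riesz representation of the derivative.\<close>

lemma GDERIV_gradient:
  fixes p :: "real^'n \<Rightarrow> real"
  assumes "real_polynomial_function p"
  shows "GDERIV p x :> gradient p x"
proof -
  obtain p' where p': "(p has_derivative p') (at x)"
    using differentiable_at_real_polynomial_function[OF assms] unfolding differentiable_def by blast
  have lin: "linear p'" using p' by (rule has_derivative_linear)
  have "p' h = h \<bullet> (\<Sum>b\<in>Basis. p' b *\<^sub>R b)" for h
  proof -
    have "p' h = p' (\<Sum>b\<in>Basis. (h \<bullet> b) *\<^sub>R b)" by (simp add: euclidean_representation)
    also have "\<dots> = (\<Sum>b\<in>Basis. (h \<bullet> b) * p' b)"
      by (simp only: linear_sum[OF lin] linear_cmul[OF lin] real_scaleR_def)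
    finally show ?thesis by (simp add: inner_sum_right mult.commute)
  qed
  then have "p' = (\<lambda>h. h \<bullet> (\<Sum>b\<in>Basis. p' b *\<^sub>R b))" by blast
  with p' have "GDERIV p x :> (\<Sum>b\<in>Basis. p' b *\<^sub>R b)" unfolding gderiv_def by simp
  then show ?thesis by (simp add: gradient_eq[OF \<open>GDERIV p x :> _\<close>])
qed

lemma square_in_SOS:
  fixes q :: "real^'n \<Rightarrow> real"
  assumes "real_polynomial_function q"
  obtains d where "\<And>d'. d \<le> d' \<Longrightarrow> (\<lambda>x. (q x)\<^sup>2) \<in> SOS d'"
proof -
  obtain d where "poly_degree_le d (\<lambda>x. (q x)\<^sup>2)"
    using real_polynomial_function_imp_poly_degree_le[OF real_polynomial_function_power[OF assms]] by blast
  moreover have "\<exists>(k::nat) q'. (\<forall>i<k. real_polynomial_function (q' i)) \<and> (\<lambda>x. (q x)\<^sup>2) = (\<lambda>x. \<Sum>i<k. (q' i x)\<^sup>2)"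
    by (rule exI[of _ 1], rule exI[of _ "\<lambda>_. q"]) (simp add: assms)
  ultimately show ?thesis
    by (intro that[of d]) (auto simp: SOS_def intro: poly_degree_le_mono)
qed

text \<open>The empty sum of squares fills the degrees below the first usable polynomial.\<close>

lemma zero_in_SOS: "(\<lambda>x::real^'n. 0) \<in> SOS d"
  unfolding SOS_def by (auto intro!: poly_degree_le_const exI[of _ "0::nat"])

context lipschitz_semiflow
begin

text \<open>For a polynomial \<open>w\<close> close to the Lyapunov function and \<open>u = w - e\<close>, the square \<open>P = (1 + u)\<^sup>2\<close>
  satisfies \<open>\<nabla>P \<bullet> f + P - 1 \<le> -u\<^sup>2 - (1 + u) e\<close>: the linear decay rate survives squaring.\<close>
lemma sos_lyapunov_function:
  assumes A: "attractor_set \<phi> A" and \<Omega>: "compact \<Omega>" "A \<subseteq> \<Omega>" "\<Omega> \<subseteq> basin_of_attraction \<phi> A"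
    and e: "0 < e" "e \<le> 1/4"
  obtains P d where "\<And>d'. d \<le> d' \<Longrightarrow> P \<in> SOS d'"
    "\<And>x. x \<in> \<Omega> \<Longrightarrow> gradient P x \<bullet> f x < - (P x - 1)"
    "\<And>x. x \<in> \<Omega> \<Longrightarrow> 1 + 2 * (infdist x A - 3 * e) < P x"
    "\<And>x. x \<in> A \<Longrightarrow> P x \<le> 1"
proof -
  obtain V L r M where V: "L-lipschitz_on UNIV V" "\<And>y. norm y > r \<Longrightarrow> V y = 0"
    "0 \<le> r" "0 \<le> M" "\<And>x. x \<in> \<Omega> \<Longrightarrow> norm x \<le> r" "\<And>x. x \<in> \<Omega> \<Longrightarrow> norm (f x) \<le> M"
    "\<And>\<kappa>. \<kappa> > 0 \<Longrightarrow> \<exists>\<delta>>0. \<exists>h0>0. \<forall>x\<in>\<Omega>. \<forall>y\<in>ball x \<delta>. \<forall>h. 0 < h \<and> h < h0 \<longrightarrow>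
       V (y + h *\<^sub>R f x) - V y \<le> h * (\<kappa> - V x)"
    and V_bounds: "\<And>x. x \<in> \<Omega> \<Longrightarrow> 0 \<le> V x" "\<And>x. x \<in> \<Omega> \<Longrightarrow> infdist x A - e \<le> V x" "\<And>x. x \<in> A \<Longrightarrow> V x = 0"
    by (rule lyapunov_function[OF A \<Omega> e(1)]) (rule that; assumption)
  have "e / 4 > 0" using e by simp
  obtain w where w: "real_polynomial_function w"
    and w_V: "\<And>x. x \<in> \<Omega> \<Longrightarrow> \<bar>w x - V x\<bar> \<le> e / 4"
    and w_deriv: "\<And>x D. x \<in> \<Omega> \<Longrightarrow> GDERIV w x :> D \<Longrightarrow> D \<bullet> f x \<le> e / 4 - V x"
    using polynomial_mollification[OF V(1,2,5,6,3,4,7) \<open>e / 4 > 0\<close>] by blast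
  \<comment> \<open>On \<open>A\<close>, where \<open>V\<close> is 0, the shift by \<open>e\<close>
    outweighs the approximation error \<open>e / 4\<close> and pushes \<open>q\<close> below
    1.\<close>
  define q where "q = (\<lambda>x. 1 - e + w x)"
  define P where "P = (\<lambda>x. (q x)\<^sup>2)"
  have "real_polynomial_function q"
    unfolding q_def by (intro real_polynomial_function.intros(2,3) w)
  from square_in_SOS[OF this] obtain d where d: "\<And>d'. d \<le> d' \<Longrightarrow> P \<in> SOS d'"
    unfolding P_def by blast
  show thesis
  proof (rule that[OF d])
    fix x assume x: "x \<in> \<Omega>"
    define u where "u = w x - e"
    have P: "P x = (1 + u)\<^sup>2" by (simp add: P_def q_def u_def algebra_simps)
    have near: "V x - e / 4 \<le> w x" "w x \<le> V x + e / 4" using w_V[OF x] by linarith+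
    have u: "u > - 1" using near V_bounds(1)[OF x] e by (simp add: u_def)
    have "GDERIV q x :> gradient w x"
      unfolding q_def using GDERIV_add[OF GDERIV_const GDERIV_gradient[OF w]] by simp
    from GDERIV_mult[OF this this] have "GDERIV P x :> (2 * q x) *\<^sub>R gradient w x"
      unfolding P_def power2_eq_square by (simp flip: scaleR_add_left)
    then have "gradient P x \<bullet> f x = 2 * (1 + u) * (gradient w x \<bullet> f x)"
      by (subst gradient_eq) (auto simp: q_def u_def)
    \<comment> \<open>The mollification error \<open>e / 4\<close> enters twice: in the derivative,
      and when \<open>V x\<close> is replaced by \<open>w x\<close>. Positivity of
      \<open>1 + u\<close> preserves the inequality.\<close>
    also have "\<dots> \<le> 2 * (1 + u) * (e / 2 - w x)"
      using w_deriv[OF x GDERIV_gradient[OF w]] near u by (intro mult_left_mono) auto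
    also have "\<dots> = - (P x - 1) - u\<^sup>2 - (1 + u) * e"
      by (simp add: P u_def power2_eq_square algebra_simps)
    also have "\<dots> < - (P x - 1)"
    proof -
      have "(1 + u) * e > 0" using u e by simp
      then show ?thesis using zero_le_power2[of u] by linarith
    qed
    finally show "gradient P x \<bullet> f x < - (P x - 1)" .
    \<comment> \<open>The losses are \<open>e\<close> from the bound on \<open>V\<close>,
      \<open>e\<close> from the shift and \<open>e / 4\<close> from the approximation.\<close>
    have "infdist x A - 3 * e < u"
      using near V_bounds(2)[OF x] e by (simp add: u_def)
    then have "1 + 2 * (infdist x A - 3 * e) < 1 + 2 * u" by simp
    also have "\<dots> \<le> P x" by (simp add: P power2_eq_square algebra_simps)
    finally show "1 + 2 * (infdist x A - 3 * e) < P x" .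
  next
    fix x assume "x \<in> A"
    then have "\<bar>w x\<bar> \<le> e / 4" using w_V[of x] V_bounds(3) \<Omega>(2) by auto
    then have "0 \<le> q x" "q x \<le> 1" using e by (auto simp: q_def abs_le_iff)
    then show "P x \<le> 1" by (simp add: P_def power_le_one)
  qed
qed

end

section \<open>Indexing by degree and convergence of volumes\<close>

text \<open>Here \<open>D n\<close> is the degree from which the \<open>n\<close>-th polynomial is
  admissible; \<open>D\<close> may be arbitrary. The largest admissible \<open>n\<close> is taken,
  with \<open>n \<le> d\<close> to keep the set of candidates finite and \<open>D 0 \<le> d\<close>
  to keep it nonempty.\<close>

lemma obtain_slow_index:
  fixes D :: "nat \<Rightarrow> nat"
  obtains k where "filterlim k at_top sequentially" "\<And>d. D 0 \<le> d \<Longrightarrow> D (k d) \<le> d"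
proof -
  define k where "k = (\<lambda>d. Max {n. n \<le> d \<and> D n \<le> d})"
  have fin: "finite {n. n \<le> d \<and> D n \<le> d}" for d by (rule finite_subset[of _ "{..d}"]) auto
  show thesis
  proof (rule that[of k])
    show "filterlim k at_top sequentially"
      unfolding filterlim_at_top
    proof
      fix n
      have "n \<le> k d" if "d \<ge> max n (D n)" for d
        unfolding k_def using that by (intro Max_ge fin) auto
      then show "eventually (\<lambda>d. n \<le> k d) sequentially" by (rule eventually_sequentiallyI)
    qed
    show "D (k d) \<le> d" if "D 0 \<le> d" for d
      using Max_in[OF fin[of d]] that unfolding k_def by fastforce
  qed
qed

text \<open>Continuity of the measure from above: the sets decrease, have finite measure inside the
  compact \<Omega>, and have empty intersection because a point at distance 0 from the closed set
  \<open>A\<close> lies in \<open>A\<close>.\<close>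

lemma emeasure_punctured_neighbourhood_tendsto_0:
  fixes A \<Omega> :: "'a::euclidean_space set" and c :: real
  assumes "closed A" "A \<noteq> {}" "compact \<Omega>" "c > 0"
  shows "(\<lambda>n. emeasure lebesgue ({x \<in> \<Omega>. infdist x A \<le> c / real (Suc n)} - A)) \<longlonglongrightarrow> 0"
proof -
  define S where "S = (\<lambda>n. {x \<in> \<Omega>. infdist x A \<le> c / real (Suc n)} - A)"
  have "closed {x \<in> \<Omega>. infdist x A \<le> c / real (Suc n)}" for n
    by (intro continuous_on_closed_Collect_le continuous_intros compact_imp_closed assms)
  then have sets: "S n \<in> sets borel" for n
    unfolding S_def using \<open>closed A\<close> by (intro sets.Diff borel_closed)
  have "(\<lambda>n. emeasure lborel (S n)) \<longlonglongrightarrow> emeasure lborel (\<Inter>n. S n)"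
  proof (rule Lim_emeasure_decseq)
    show "range S \<subseteq> sets lborel" using sets by auto
    show "decseq S"
    proof (rule decseq_SucI)
      show "S (Suc n) \<subseteq> S n" for n
      proof -
        have "c / real (Suc (Suc n)) \<le> c / real (Suc n)"
          using \<open>c > 0\<close> by (intro divide_left_mono) auto
        then show ?thesis by (auto simp: S_def simp del: of_nat_Suc)
      qed
    qed
    show "emeasure lborel (S n) \<noteq> \<infinity>" for n
    proof -
      have "bounded (S n)"
        by (rule bounded_subset[OF compact_imp_bounded[OF \<open>compact \<Omega>\<close>]]) (auto simp: S_def)
      then show ?thesis using emeasure_bounded_finite by force
    qed
  qed
  moreover have "(\<Inter>n. S n) = {}"
  proof -
    have False if x: "\<And>n. x \<in> S n" for x
    proof -
      have "x \<notin> A" using x[of 0] by (simp add: S_def)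
      then have "infdist x A > 0"
        using in_closed_iff_infdist_zero[OF assms(1,2), of x] infdist_nonneg[of x A] by linarith
      moreover have "(\<lambda>n. c / real (Suc n)) \<longlonglongrightarrow> 0" using LIMSEQ_Suc[OF lim_const_over_n[of c]] by simp
      then have "infdist x A \<le> 0"
        by (rule tendsto_lowerbound) (use x in \<open>auto simp: S_def\<close>)
      ultimately show False by simp
    qed
    then show ?thesis by blast
  qed
  ultimately have "(\<lambda>n. emeasure lborel (S n)) \<longlonglongrightarrow> 0" by (simp only: emeasure_empty)
  moreover have "emeasure lebesgue (S n) = emeasure lborel (S n)" for n using sets by simp
  ultimately have "(\<lambda>n. emeasure lebesgue (S n)) \<longlonglongrightarrow> 0" by (simp only:)
  then show ?thesis unfolding S_def .
qed

theorem theorem8: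
  fixes f :: "real^'n \<Rightarrow> real^'n"
    and \<phi> :: "real^'n \<Rightarrow> real \<Rightarrow> real^'n"
    and A \<Omega> :: "(real^'n) set"
  assumes "local_lipschitz (UNIV :: real set) UNIV (\<lambda>_. f)"
    and "unique_solution_map f \<phi>"
    and "attractor_set \<phi> A"
    and "compact \<Omega>"
    and "A \<subseteq> interior \<Omega>"
    and "\<Omega> \<subseteq> basin_of_attraction \<phi> A"
  shows "\<exists>(P :: nat \<Rightarrow> real^'n \<Rightarrow> real) (\<alpha>::real) (N::nat).
    (\<forall>d. P d \<in> SOS d) \<and> \<alpha> > 0 \<and>
    (\<forall>d\<ge>N. \<forall>x\<in>\<Omega>. gradient (P d) x \<bullet> f x < - (P d x - 1)) \<and>
    (\<forall>d\<ge>N. \<forall>x\<in>frontier \<Omega>. P d x > 1 + \<alpha>) \<and>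
    (\<forall>d\<ge>N. A \<subseteq> {x\<in>\<Omega>. P d x \<le> 1}) \<and>
    (\<lambda>d. volume_dist A {x\<in>\<Omega>. P d x \<le> 1}) \<longlonglongrightarrow> 0"
proof -
  interpret lipschitz_semiflow f \<phi>
    using assms(1,2) by unfold_locales (auto simp: unique_solution_map_def)
  have "closed A" "A \<noteq> {}" using assms(3) by (auto simp: attractor_set_def compact_imp_closed)
  have "A \<subseteq> \<Omega>" using assms(5) interior_subset by blast
  have "closed \<Omega>" using assms(4) by (rule compact_imp_closed)
  \<comment> \<open>The number \<open>m\<close> will serve as \<alpha>. It is capped at 1 so that
    \<open>e n \<le> m / 8\<close> meets the bound \<open>1/4\<close> required of
    \<open>e\<close>.\<close>
  obtain m where m: "0 < m" "m \<le> 1" "\<And>x. x \<in> frontier \<Omega> \<Longrightarrow> m \<le> infdist x A"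
  proof (cases "frontier \<Omega> = {}")
    case False
    have "continuous_on (frontier \<Omega>) (\<lambda>x. infdist x A)" by (intro continuous_intros)
    then obtain z where z: "z \<in> frontier \<Omega>" "\<And>x. x \<in> frontier \<Omega> \<Longrightarrow> infdist z A \<le> infdist x A"
      using continuous_attains_inf[OF compact_frontier[OF assms(4)] False] by blast
    have "z \<notin> A" using z(1) assms(5) by (auto simp: frontier_def)
    then have "infdist z A > 0"
      using in_closed_iff_infdist_zero[OF \<open>closed A\<close> \<open>A \<noteq> {}\<close>, of z] infdist_nonneg[of z A] by linarith
    then show ?thesis using z(2) by (intro that[of "min 1 (infdist z A)"]) (auto intro: min.coboundedI2)
  qed (use that[of 1] in auto)
  define e where "e = (\<lambda>n. m / 8 / real (Suc n))"
  have e: "0 < e n" "e n \<le> m / 8" for n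
    using m(1) by (auto simp: e_def field_simps)
  have "\<exists>P d. (\<forall>d'\<ge>d. P \<in> SOS d') \<and> (\<forall>x\<in>\<Omega>. gradient P x \<bullet> f x < - (P x - 1)) \<and>
      (\<forall>x\<in>\<Omega>. 1 + 2 * (infdist x A - 3 * e n) < P x) \<and> (\<forall>x\<in>A. P x \<le> 1)" for n
  proof -
    have "e n \<le> 1/4" using e(2)[of n] m(2) by simp
    from sos_lyapunov_function[OF assms(3,4) \<open>A \<subseteq> \<Omega>\<close> assms(6) e(1) this]
    show ?thesis by metis
  qed
  then obtain Q D where Q: "\<And>n d. D n \<le> d \<Longrightarrow> Q n \<in> SOS d"
    "\<And>n x. x \<in> \<Omega> \<Longrightarrow> gradient (Q n) x \<bullet> f x < - (Q n x - 1)"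
    "\<And>n x. x \<in> \<Omega> \<Longrightarrow> 1 + 2 * (infdist x A - 3 * e n) < Q n x"
    "\<And>n x. x \<in> A \<Longrightarrow> Q n x \<le> 1"
    by metis
  obtain k where k: "filterlim k at_top sequentially" "\<And>d. D 0 \<le> d \<Longrightarrow> D (k d) \<le> d"
    using obtain_slow_index by blast
  \<comment> \<open>Below degree \<open>D 0\<close> no polynomial is available yet and 0 is used;
    accordingly \<open>N\<close> is \<open>D 0\<close>.\<close>
  define P where "P = (\<lambda>d. if D 0 \<le> d then Q (k d) else (\<lambda>x. 0))"
  have P: "P d = Q (k d)" if "d \<ge> D 0" for d using that by (simp add: P_def)
  have "P d \<in> SOS d" for d using Q(1)[OF k(2)] by (simp add: P_def zero_in_SOS)
  moreover have "P d x > 1 + m" if "d \<ge> D 0" "x \<in> frontier \<Omega>" for d x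
  proof -
    have "x \<in> \<Omega>" using that(2) frontier_subset_closed[OF \<open>closed \<Omega>\<close>] by blast
    \<comment> \<open>Since \<open>3 * e n \<le> 3 * m / 8\<close>, the lower bound is at least
      \<open>1 + 5 * m / 4\<close>, which exceeds \<open>1 + m\<close>.\<close>
    from Q(3)[OF this, of "k d"] show ?thesis
      using e(2)[of "k d"] m(1) m(3)[OF that(2)] by (simp add: P[OF that(1)])
  qed
  moreover have "(\<lambda>d. volume_dist A {x\<in>\<Omega>. P d x \<le> 1}) \<longlonglongrightarrow> 0"
  proof (rule tendsto_sandwich[OF _ _ tendsto_const])
    \<comment> \<open>As \<open>A\<close> lies in the sublevel set, only the excess outside
      \<open>A\<close> is measured, and the lower bound on \<open>Q n\<close> confines it to
      distance at most \<open>3 * e n\<close> from \<open>A\<close>.\<close>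
    let ?S = "\<lambda>n. {x \<in> \<Omega>. infdist x A \<le> 3 * m / 8 / real (Suc n)} - A"
    have "volume_dist A {x\<in>\<Omega>. P d x \<le> 1} \<le> emeasure lebesgue (?S (k d))" if d: "d \<ge> D 0" for d
      unfolding volume_dist_def
    proof (rule emeasure_mono)
      have "infdist x A \<le> 3 * m / 8 / real (Suc (k d))" if "x \<in> \<Omega>" "P d x \<le> 1" for x
        using Q(3)[OF that(1), of "k d"] that(2) unfolding P[OF d] e_def by simp
      moreover have "A \<subseteq> {x\<in>\<Omega>. P d x \<le> 1}" using Q(4) \<open>A \<subseteq> \<Omega>\<close> by (auto simp: P[OF d])
      ultimately show "A - {x\<in>\<Omega>. P d x \<le> 1} \<union> ({x\<in>\<Omega>. P d x \<le> 1} - A) \<subseteq> ?S (k d)" by blast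
      have "closed {x \<in> \<Omega>. infdist x A \<le> 3 * m / 8 / real (Suc (k d))}"
        by (intro continuous_on_closed_Collect_le continuous_intros \<open>closed \<Omega>\<close>)
      then show "?S (k d) \<in> sets lebesgue"
        using \<open>closed A\<close> by (intro sets.Diff) auto
    qed
    then show "eventually (\<lambda>d. volume_dist A {x\<in>\<Omega>. P d x \<le> 1} \<le> emeasure lebesgue (?S (k d))) sequentially"
      by (rule eventually_sequentiallyI)
    show "(\<lambda>d. emeasure lebesgue (?S (k d))) \<longlonglongrightarrow> 0"
      using m(1) \<open>closed A\<close> \<open>A \<noteq> {}\<close> assms(4)
      by (intro filterlim_compose[OF emeasure_punctured_neighbourhood_tendsto_0 k(1)]) auto
  qed simp
  moreover have "gradient (P d) x \<bullet> f x < - (P d x - 1)" if "d \<ge> D 0" "x \<in> \<Omega>" for d x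
    using Q(2)[OF that(2)] by (simp add: P[OF that(1)])
  moreover have "A \<subseteq> {x\<in>\<Omega>. P d x \<le> 1}" if "d \<ge> D 0" for d
    using Q(4) \<open>A \<subseteq> \<Omega>\<close> by (auto simp: P[OF that])
  ultimately show ?thesis
    using m(1) by (intro exI[of _ P] exI[of _ m] exI[of _ "D 0"] conjI) blast+
qed

end
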